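(* Let $(\mathcal{A},\mathbb{E})$ be a $B$-valued probability space, $\chi:[n]\to\{\mathcal{F},\mathcal{B}\}$, $\pi\in INC(\chi)$ and $a_1,\dots,a_n\in\mathcal{A}$. Suppose $V=\{l+1,l+2,\dots,l+s\}$ is an interval block of $\pi$ and let $V'=[n]\setminus V$. Then $$\kappa_{\chi,\pi}(a_1,\dots,a_n)=\kappa_{\chi|_{V'},\pi|_{V'}}\big(a_1,\dots,a_l,\kappa_{\chi|_V,1_V}(a_{l+1},\dots,a_{l+s})a_{l+s+1},\dots,a_n\big)=\kappa_{\chi|_{V'},\pi|_{V'}}\big(a_1,\dots,a_l\kappa_{\chi|_V,1_V}(a_{l+1},\dots,a_{l+s}),a_{l+s+1},\dots,a_n\big).$$
   Context: $B$ is a unital complex algebra; a $B$-valued probability space is a pair $(\mathcal{A},\mathbb{E})$ with $\mathcal{A}$ a unital algebra containing $B$ and $\mathbb{E}:\mathcal{A}\to B$ linear with $\mathbb{E}(b_1ab_2)=b_1\mathbb{E}(a)b_2$. For a finite linearly ordered set $S$ and $\chi:S\to\{\mathcal{F},\mathcal{B}\}$, $INC(\chi)$ is the set of noncrossing partitions $\pi$ of $S$ such that whenever $v_1<w<v_2$, $v_1,v_2$ are in the same block and $\chi(w)=\mathcal{B}$, then $w$ is in that block; it is ordered by reverse refinement ($\sigma\le\pi$ iff every block of $\sigma$ lies in a block of $\pi$), $\mu_{INC}$ is its Möbius function, and $1_S$ is the one-block partition. Restrictions $\chi|_W$, $\pi|_W$ to a subset $W$ are taken with the induced order. For a noncrossing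 $\sigma$ of $[n]$ and $a_1,\dots,a_n\in\mathcal{A}$, $\Phi_\sigma(a_1,\dots,a_n)\in B$ is defined recursively: $\Phi_{1_n}(a_1,\dots,a_n)=\mathbb{E}(a_1\cdots a_n)$ and, if $W=\{l+1,\dots,l+s\}$ is an interval block of $\sigma$, $\Phi_\sigma(a_1,\dots,a_n)=\Phi_{\sigma\setminus\{W\}}(a_1,\dots,a_l,\mathbb{E}(a_{l+1}\cdots a_{l+s})a_{l+s+1},\dots,a_n)$. The free-Boolean cumulant is $\kappa_{\chi,\pi}(a_1,\dots,a_n)=\sum_{\sigma\in INC(\chi),\sigma\le\pi}\mu_{INC}(\sigma,\pi)\Phi_\sigma(a_1,\dots,a_n)$. *)

theory Defs
  imports Complex_Main "HOL-Library.Disjoint_Sets"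
begin

text \<open>The ambient unital complex algebra is modelled as a type 'a of class ring_1
  together with a unital ring homomorphism iota from the complex numbers into the
  centre of 'a (this is what a unital complex algebra structure on a ring is).
  B is a unital complex subalgebra given as a subset of 'a.\<close>

definition complex_alg :: "(complex \<Rightarrow> 'a::ring_1) \<Rightarrow> bool" where
  "complex_alg \<iota> \<longleftrightarrow> \<iota> 1 = 1 \<and> (\<forall>x y. \<iota> (x + y) = \<iota> x + \<iota> y \<and> \<iota> (x * y) = \<iota> x * \<iota> y)
     \<and> (\<forall>c a. \<iota> c * a = a * \<iota> c)"

definition unital_subalg :: "(complex \<Rightarrow> 'a::ring_1) \<Rightarrow> 'a set \<Rightarrow> bool" where
  "unital_subalg \<iota> B \<longleftrightarrow> 1 \<in> B \<and> (\<forall>x\<in>B. \<forall>y\<in>B. x + y \<in> B \<and> x * y \<in> B)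
     \<and> (\<forall>c. \<forall>x\<in>B. \<iota> c * x \<in> B)"

definition B_prob_space :: "(complex \<Rightarrow> 'a::ring_1) \<Rightarrow> 'a set \<Rightarrow> ('a \<Rightarrow> 'a) \<Rightarrow> bool" where
  "B_prob_space \<iota> B E \<longleftrightarrow> complex_alg \<iota> \<and> unital_subalg \<iota> B \<and> range E \<subseteq> B
     \<and> (\<forall>x y. E (x + y) = E x + E y) \<and> (\<forall>c x. E (\<iota> c * x) = \<iota> c * E x)
     \<and> (\<forall>b1\<in>B. \<forall>b2\<in>B. \<forall>x. E (b1 * x * b2) = b1 * E x * b2)"

datatype fb = Fr | Bo  \<comment> \<open>\<open>Fr\<close> = free (F), \<open>Bo\<close> = Boolean (B)\<close>

text \<open>Finite linearly ordered sets are finite sets of natural numbers with the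
  induced order; partitions are sets of blocks.\<close>

definition noncrossing :: "nat set set \<Rightarrow> bool" where
  "noncrossing \<pi> \<longleftrightarrow> (\<forall>V\<in>\<pi>. \<forall>W\<in>\<pi>. V \<noteq> W \<longrightarrow>
     \<not> (\<exists>a\<in>V. \<exists>b\<in>W. \<exists>c\<in>V. \<exists>d\<in>W. a < b \<and> b < c \<and> c < d))"

definition INC :: "(nat \<Rightarrow> fb) \<Rightarrow> nat set \<Rightarrow> nat set set set" where
  "INC \<chi> S = {\<pi>. partition_on S \<pi> \<and> noncrossing \<pi> \<and>
     (\<forall>V\<in>\<pi>. \<forall>v1\<in>V. \<forall>v2\<in>V. \<forall>w\<in>S. v1 < w \<and> w < v2 \<and> \<chi> w = Bo \<longrightarrow> w \<in> V)}"

definition refines :: "nat set set \<Rightarrow> nat set set \<Rightarrow> bool" where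
  "refines \<sigma> \<pi> \<longleftrightarrow> (\<forall>V\<in>\<sigma>. \<exists>W\<in>\<pi>. V \<subseteq> W)"

definition restrict_part :: "nat set set \<Rightarrow> nat set \<Rightarrow> nat set set" where
  "restrict_part \<pi> W = (\<lambda>V. V \<inter> W) ` \<pi> - {{}}"

text \<open>mu(s,s) = 1, mu(s,p) = - sum over s <= r < p of mu(s,r) for s < p, 0 otherwise.
  The recursion is implemented with fuel; card P fuel always suffices.\<close>
fun mob_aux :: "('p \<Rightarrow> 'p \<Rightarrow> bool) \<Rightarrow> 'p set \<Rightarrow> nat \<Rightarrow> 'p \<Rightarrow> 'p \<Rightarrow> int" where
  "mob_aux le P 0 s p = (if s = p then 1 else 0)"
| "mob_aux le P (Suc k) s p =
     (if s = p then 1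
      else if le s p then - (\<Sum>r\<in>{r\<in>P. le s r \<and> le r p \<and> r \<noteq> p}. mob_aux le P k s r)
      else 0)"

definition mobius :: "('p \<Rightarrow> 'p \<Rightarrow> bool) \<Rightarrow> 'p set \<Rightarrow> 'p \<Rightarrow> 'p \<Rightarrow> int" where
  "mobius le P s p = mob_aux le P (card P) s p"

definition ordprod :: "nat set \<Rightarrow> (nat \<Rightarrow> 'a::monoid_mult) \<Rightarrow> 'a" where
  "ordprod S a = prod_list (map a (sorted_list_of_set S))"

text \<open>W is an interval block of sigma (w.r.t. the induced order on S) not containing
  the last element of S, so that the recursion of Phi applies to it.\<close>
definition rec_block :: "nat set \<Rightarrow> nat set set \<Rightarrow> nat set \<Rightarrow> bool" where
  "rec_block S \<sigma> W \<longleftrightarrow> W \<in> \<sigma> \<and> (\<forall>j\<in>S. Min W \<le> j \<and> j \<le> Max W \<longrightarrow> j \<in> W) \<and> Max S \<notin> W"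

definition next_after :: "nat set \<Rightarrow> nat set \<Rightarrow> nat" where
  "next_after S W = Min {j\<in>S. Max W < j}"

text \<open>The recursion uses (say) the leftmost admissible interval block; by the
  well-definedness of Phi any choice gives the same value.\<close>
fun phi_aux :: "('a::ring_1 \<Rightarrow> 'a) \<Rightarrow> nat \<Rightarrow> nat set \<Rightarrow> nat set set \<Rightarrow> (nat \<Rightarrow> 'a) \<Rightarrow> 'a" where
  "phi_aux E 0 S \<sigma> a = E (ordprod S a)"
| "phi_aux E (Suc k) S \<sigma> a =
     (if \<exists>W. rec_block S \<sigma> W then
        (let W = (SOME W. rec_block S \<sigma> W \<and> (\<forall>W'. rec_block S \<sigma> W' \<longrightarrow> Min W \<le> Min W'));
             m = next_after S W
         in phi_aux E k (S - W) (\<sigma> - {W}) (a(m := E (ordprod W a) * a m)))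
      else E (ordprod S a))"

definition Phi :: "('a::ring_1 \<Rightarrow> 'a) \<Rightarrow> nat set \<Rightarrow> nat set set \<Rightarrow> (nat \<Rightarrow> 'a) \<Rightarrow> 'a" where
  "Phi E S \<sigma> a = phi_aux E (card \<sigma> - 1) S \<sigma> a"

text \<open>kappa_{chi,pi}(a_i : i in S), with chi only used on S (so kappa E chi W is the
  cumulant for the restriction chi|_W).\<close>
definition kappa :: "('a::ring_1 \<Rightarrow> 'a) \<Rightarrow> (nat \<Rightarrow> fb) \<Rightarrow> nat set \<Rightarrow> nat set set \<Rightarrow> (nat \<Rightarrow> 'a) \<Rightarrow> 'a" where
  "kappa E \<chi> S \<pi> a =
     (\<Sum>\<sigma>\<in>{\<sigma>\<in>INC \<chi> S. refines \<sigma> \<pi>}. of_int (mobius refines (INC \<chi> S) \<sigma> \<pi>) * Phi E S \<sigma> a)"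

end

theory Submission
  imports Defs
begin

text \<open>Since \<open>V\<close> is an interval block of \<open>\<pi>\<close>, the map \<open>(\<tau>, \<rho>) \<mapsto> \<tau> \<union> \<rho>\<close> is an isomorphism from
  the product of the down-set of \<open>\<pi> - {V}\<close> in \<open>INC \<chi> (S - V)\<close> and \<open>INC \<chi> V\<close> onto the down-set of \<open>\<pi>\<close>;
  the Boolean condition for \<open>\<tau> \<union> \<rho>\<close> is inherited from \<open>\<pi>\<close>. Hence the Moebius function factorises.
  On the other side \<open>\<Phi>\<close> does not depend on the order in which interval blocks are removed, so removing
  the blocks of \<open>\<rho>\<close> first expresses \<open>\<Phi>\<close> at \<open>\<tau> \<union> \<rho>\<close> as \<open>\<Phi>\<close> at \<open>\<tau>\<close> with \<open>\<Phi>\<close> at \<open>\<rho>\<close> multiplied into a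
  neighbouring argument; an element of \<open>B\<close> may be moved between adjacent arguments. Summing over \<open>\<rho>\<close>
  and using multilinearity of \<open>\<Phi>\<close> at \<open>\<tau>\<close> gives the claim.\<close>

section \<open>Moebius functions of finite posets\<close>

locale finite_poset =
  fixes le :: "'p \<Rightarrow> 'p \<Rightarrow> bool" and P :: "'p set"
  assumes finite_P: "finite P"
    and refl: "x \<in> P \<Longrightarrow> le x x"
    and antisym: "\<lbrakk>x \<in> P; y \<in> P; le x y; le y x\<rbrakk> \<Longrightarrow> x = y"
    and trans: "\<lbrakk>x \<in> P; y \<in> P; z \<in> P; le x y; le y z\<rbrakk> \<Longrightarrow> le x z"
begin

text \<open>The size of the half-open interval from \<open>s\<close> to \<open>p\<close>, with
  \<open>p\<close> left out, is the measure for the inductions below; it drops because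
  \<open>r\<close> lies in the larger interval but not in its own.\<close>

lemma card_below_mono:
  assumes "s \<in> P" "p \<in> P" "r \<in> P" "le s r" "le r p" "r \<noteq> p"
  shows "card {t\<in>P. le s t \<and> le t r \<and> t \<noteq> r} < card {t\<in>P. le s t \<and> le t p \<and> t \<noteq> p}"
proof (rule psubset_card_mono)
  show "finite {t\<in>P. le s t \<and> le t p \<and> t \<noteq> p}" using finite_P by simp
  have "{t\<in>P. le s t \<and> le t r \<and> t \<noteq> r} \<subseteq> {t\<in>P. le s t \<and> le t p \<and> t \<noteq> p}"
  proof
    fix t assume "t \<in> {t\<in>P. le s t \<and> le t r \<and> t \<noteq> r}"
    then have t: "t \<in> P" "le s t" "le t r" "t \<noteq> r" by auto
    have "le t p" using trans t assms by blast
    moreover have "t \<noteq> p" using antisym t assms by blast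
    ultimately show "t \<in> {t\<in>P. le s t \<and> le t p \<and> t \<noteq> p}" using t by blast
  qed
  moreover have "r \<in> {t\<in>P. le s t \<and> le t p \<and> t \<noteq> p}" using assms by blast
  ultimately show "{t\<in>P. le s t \<and> le t r \<and> t \<noteq> r} \<subset> {t\<in>P. le s t \<and> le t p \<and> t \<noteq> p}"
    by blast
qed

text \<open>Each recursive call moves to a point with a strictly smaller half-open interval above
  \<open>s\<close>, so fuel of at least the size of that interval never runs out and a surplus
  changes nothing.\<close>

lemma mob_aux_fuel:
  assumes "s \<in> P" "p \<in> P"
    and "card {t\<in>P. le s t \<and> le t p \<and> t \<noteq> p} \<le> k" "card {t\<in>P. le s t \<and> le t p \<and> t \<noteq> p} \<le> k'"
  shows "mob_aux le P k s p = mob_aux le P k' s p"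
  using assms
proof (induction k arbitrary: p k')
  case 0
  \<comment> \<open>An empty half-open interval excludes \<open>s\<close> strictly below
    \<open>p\<close>, since \<open>s\<close> itself would belong to it.\<close>
  then have "\<not> (le s p \<and> s \<noteq> p)" using refl finite_P by auto
  then show ?case by (cases k') auto
next
  case (Suc k)
  show ?case
  proof (cases "le s p \<and> s \<noteq> p")
    case True
    then have "s \<in> {t\<in>P. le s t \<and> le t p \<and> t \<noteq> p}" using Suc refl by auto
    then have "card {t\<in>P. le s t \<and> le t p \<and> t \<noteq> p} > 0"
      using finite_P by (auto simp: card_gt_0_iff)
    then obtain k2 where k2: "k' = Suc k2" using Suc.prems by (cases k') auto
    have "mob_aux le P k s r = mob_aux le P k2 s r"
      if "r \<in> {r\<in>P. le s r \<and> le r p \<and> r \<noteq> p}" for r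
      using that card_below_mono[of s p r] Suc.prems k2 by (intro Suc.IH) auto
    then show ?thesis using k2 by simp
  next
    case False
    then show ?thesis by (cases k') auto
  qed
qed

lemma mobius_self: "mobius le P s s = 1"
  by (cases "card P") (simp_all add: mobius_def)

lemma mobius_rec:
  assumes "s \<in> P" "p \<in> P" "le s p" "s \<noteq> p"
  shows "mobius le P s p = - (\<Sum>r\<in>{r\<in>P. le s r \<and> le r p \<and> r \<noteq> p}. mobius le P s r)"
proof -
  have "card P > 0" using assms finite_P by (auto simp: card_gt_0_iff)
  then obtain k where k: "card P = Suc k" by (cases "card P") auto
  \<comment> \<open>The outer call spends one unit of \<open>card P\<close>; the rest suffices
    because the half-open interval below \<open>r\<close> misses \<open>r\<close>.\<close>
  have fuel: "card {t\<in>P. le s t \<and> le t r \<and> t \<noteq> r} \<le> k" if "r \<in> P" for r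
  proof -
    have "{t\<in>P. le s t \<and> le t r \<and> t \<noteq> r} \<subset> P" using that by blast
    from psubset_card_mono[OF finite_P this] show ?thesis using k by simp
  qed
  have "mobius le P s p = - (\<Sum>r\<in>{r\<in>P. le s r \<and> le r p \<and> r \<noteq> p}. mob_aux le P k s r)"
    using assms by (simp add: mobius_def k)
  also have "\<dots> = - (\<Sum>r\<in>{r\<in>P. le s r \<and> le r p \<and> r \<noteq> p}. mobius le P s r)"
    unfolding mobius_def k using fuel assms
    by (intro arg_cong[where f = uminus] sum.cong refl mob_aux_fuel) (auto intro: le_SucI)
  finally show ?thesis .
qed

text \<open>This is the convolution identity of the Moebius and zeta functions, the form that suits
  products of posets.\<close>

lemma sum_mobius:
  assumes "s \<in> P" "p \<in> P" "le s p"
  shows "(\<Sum>r\<in>{r\<in>P. le s r \<and> le r p}. mobius le P s r) = (if s = p then 1 else 0)"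
proof (cases "s = p")
  case True
  then have "{r\<in>P. le s r \<and> le r p} = {p}" using assms refl antisym by blast
  then show ?thesis using True by (simp add: mobius_self)
next
  case False
  have "{r\<in>P. le s r \<and> le r p} = insert p {r\<in>P. le s r \<and> le r p \<and> r \<noteq> p}"
    using assms refl by blast
  then have "(\<Sum>r\<in>{r\<in>P. le s r \<and> le r p}. mobius le P s r)
      = mobius le P s p + (\<Sum>r\<in>{r\<in>P. le s r \<and> le r p \<and> r \<noteq> p}. mobius le P s r)"
    using finite_P by simp
  then show ?thesis using mobius_rec[OF assms False] False by simp
qed

text \<open>By induction \<open>g\<close> agrees with the Moebius function strictly below
  \<open>p\<close>; the full sums up to \<open>p\<close> agree as well, so the remaining terms at
  \<open>p\<close> coincide. Only points \<open>q\<close> between \<open>s\<close> and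
  \<open>p\<close> enter, which fits a product structure that exists only below a fixed
  \<pi>.\<close>

lemma mobius_unique:
  assumes "s \<in> P" "p \<in> P" "le s p"
    and "\<And>q. \<lbrakk>q \<in> P; le s q; le q p\<rbrakk> \<Longrightarrow>
      (\<Sum>r\<in>{r\<in>P. le s r \<and> le r q}. g r) = (if s = q then 1 else (0::int))"
  shows "mobius le P s p = g p"
  using assms(2-)
proof (induction "card {t\<in>P. le s t \<and> le t p \<and> t \<noteq> p}" arbitrary: p rule: less_induct)
  case less
  let ?D = "{r\<in>P. le s r \<and> le r p \<and> r \<noteq> p}"
  have below: "mobius le P s r = g r" if "r \<in> ?D" for r
  proof (rule less.hyps)
    show "card {t\<in>P. le s t \<and> le t r \<and> t \<noteq> r} < card ?D"
      using that less.prems assms(1) by (intro card_below_mono) auto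
    show "(\<Sum>t\<in>{t\<in>P. le s t \<and> le t q}. g t) = (if s = q then 1 else 0)"
      if "q \<in> P" "le s q" "le q r" for q
      using that \<open>r \<in> ?D\<close> less.prems trans[of q r p] by auto
  qed (use that in auto)
  have split: "{r\<in>P. le s r \<and> le r p} = insert p ?D"
    using less.prems refl by blast
  have "(\<Sum>r\<in>insert p ?D. mobius le P s r) = (\<Sum>r\<in>insert p ?D. g r)"
    using sum_mobius[OF assms(1) less.prems(1,2)] less.prems(3)[OF less.prems(1,2)] less.prems(1) refl
    unfolding split by simp
  moreover have "sum (mobius le P s) ?D = sum g ?D" using below by (rule sum.cong[OF HOL.refl])
  ultimately show ?case using finite_P by simp
qed

end

section \<open>Ordered products and interval blocks\<close>

lemma ordprod_cong: "(\<And>i. i \<in> S \<Longrightarrow> a i = b i) \<Longrightarrow> ordprod S a = ordprod S b"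
  unfolding ordprod_def
  by (rule arg_cong[where f = prod_list], cases "finite S") simp_all

lemma ordprod_Un:
  assumes "finite A" "finite B" "\<And>x y. \<lbrakk>x \<in> A; y \<in> B\<rbrakk> \<Longrightarrow> x < y"
  shows "ordprod (A \<union> B) a = ordprod A a * ordprod B a"
proof -
  have "sorted_list_of_set (A \<union> B) = sorted_list_of_set A @ sorted_list_of_set B"
    using assms
    by (intro sorted_distinct_set_unique) (auto simp: sorted_append intro: less_imp_le)
  then show ?thesis by (simp add: ordprod_def)
qed

lemma ordprod_empty [simp]: "ordprod {} a = 1"
  and ordprod_singleton [simp]: "ordprod {i} a = a i"
  by (simp_all add: ordprod_def)

lemma ordprod_split:
  assumes "finite S" "i \<in> S"
  shows "ordprod S a = ordprod {j\<in>S. j < i} a * a i * ordprod {j\<in>S. i < j} a"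
proof -
  have "S = ({j\<in>S. j < i} \<union> {i}) \<union> {j\<in>S. i < j}" using assms by auto
  then have "ordprod S a = ordprod (({j\<in>S. j < i} \<union> {i}) \<union> {j\<in>S. i < j}) a"
    by (rule arg_cong)
  also have "\<dots> = ordprod ({j\<in>S. j < i} \<union> {i}) a * ordprod {j\<in>S. i < j} a"
    using assms by (intro ordprod_Un) auto
  also have "ordprod ({j\<in>S. j < i} \<union> {i}) a = ordprod {j\<in>S. j < i} a * ordprod {i} a"
    using assms by (intro ordprod_Un) auto
  also have "\<dots> = ordprod {j\<in>S. j < i} a * a i"
    by (simp add: ordprod_def)
  finally show ?thesis .
qed

lemma ordprod_upd:
  assumes "finite S" "i \<in> S"
  shows "ordprod S (a(i := x)) = ordprod {j\<in>S. j < i} a * x * ordprod {j\<in>S. i < j} a"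
  using ordprod_split[OF assms, of "a(i := x)"]
    ordprod_cong[of "{j\<in>S. j < i}" "a(i := x)" a] ordprod_cong[of "{j\<in>S. i < j}" "a(i := x)" a]
  by simp

lemma ordprod_upd_first:
  assumes "finite S" "i \<in> S" "\<And>j. j \<in> S \<Longrightarrow> i \<le> j"
  shows "ordprod S (a(i := b * a i)) = b * ordprod S a"
proof -
  have "{j\<in>S. j < i} = {}" using assms by fastforce
  then show ?thesis using assms
    by (simp only: ordprod_upd ordprod_split[of S i a] ordprod_empty) (simp add: mult.assoc)
qed

lemma ordprod_upd_last:
  assumes "finite S" "i \<in> S" "\<And>j. j \<in> S \<Longrightarrow> j \<le> i"
  shows "ordprod S (a(i := a i * b)) = ordprod S a * b"
proof -
  have "{j\<in>S. i < j} = {}" using assms by fastforce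
  then show ?thesis using assms
    by (simp only: ordprod_upd ordprod_split[of S i a] ordprod_empty) (simp add: mult.assoc)
qed

text \<open>\<open>i\<close> and \<open>j\<close> are neighbours in \<open>S\<close>, so the product
  can be cut between them; \<open>b\<close> ends the left part or begins the right part.\<close>

lemma ordprod_shift:
  assumes "finite S" "i \<in> S" "j \<in> S" "i < j" "\<And>k. k \<in> S \<Longrightarrow> k \<le> i \<or> j \<le> k"
  shows "ordprod S (a(j := b * a j)) = ordprod S (a(i := a i * b))"
proof -
  let ?L = "{k\<in>S. k \<le> i}" and ?R = "{k\<in>S. j \<le> k}"
  have S: "S = ?L \<union> ?R" using assms by auto
  have un: "ordprod S c = ordprod ?L c * ordprod ?R c" for c :: "nat \<Rightarrow> 'a"
    by (subst S, subst ordprod_Un) (use assms in auto)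
  have "ordprod S (a(j := b * a j)) = ordprod ?L a * (b * ordprod ?R a)"
    unfolding un using assms
    by (subst ordprod_upd_first) (auto intro!: arg_cong2[where f = "(*)"] ordprod_cong)
  moreover have "ordprod S (a(i := a i * b)) = (ordprod ?L a * b) * ordprod ?R a"
    unfolding un using assms
    by (subst ordprod_upd_last) (auto intro!: arg_cong2[where f = "(*)"] ordprod_cong)
  ultimately show ?thesis by (simp add: mult.assoc)
qed

section \<open>Intervals of a finite ordered set and their right neighbours\<close>

definition convex_in :: "nat set \<Rightarrow> nat set \<Rightarrow> bool" where
  "convex_in S W \<longleftrightarrow> W \<noteq> {} \<and> W \<subseteq> S \<and> (\<forall>i\<in>W. \<forall>k\<in>W. \<forall>j\<in>S. i < j \<and> j < k \<longrightarrow> j \<in> W)"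

text \<open>For an interval \<open>W\<close> this characterises the least element of
  \<open>S\<close> above \<open>W\<close>. Being a relation rather than a \<open>Min\<close>, it is
  easily transported when \<open>S\<close> or \<open>W\<close> changes.\<close>

definition is_next :: "nat set \<Rightarrow> nat set \<Rightarrow> nat \<Rightarrow> bool" where
  "is_next S W m \<longleftrightarrow> m \<in> S \<and> (\<forall>i\<in>W. i < m) \<and> (\<forall>j\<in>S. j \<notin> W \<longrightarrow> m \<le> j \<or> (\<forall>i\<in>W. j < i))"

lemma next_after_eqI:
  assumes "finite S" "convex_in S W" "is_next S W m"
  shows "next_after S W = m"
proof -
  have W: "finite W" "W \<noteq> {}" using assms by (auto simp: convex_in_def intro: finite_subset[of _ S])
  have "m \<in> {j\<in>S. Max W < j}" using W assms by (auto simp: is_next_def)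
  moreover have "m \<le> j" if j: "j \<in> {j\<in>S. Max W < j}" for j
  proof -
    have "j \<notin> W" using j W Max_ge[of W j] by auto
    moreover have "Max W \<in> W" using W by simp
    moreover have "\<not> j < Max W" using j by simp
    ultimately show ?thesis using j assms(3) unfolding is_next_def by blast
  qed
  ultimately show ?thesis unfolding next_after_def using assms(1) by (intro Min_eqI) auto
qed

text \<open>\<open>Max S\<close> lies above \<open>W\<close>, so there is a least element above
  \<open>W\<close>. A point outside \<open>W\<close> that is not above all of \<open>W\<close> is
  below all of it by convexity.\<close>

lemma is_next_exists:
  assumes "finite S" "convex_in S W" "Max S \<notin> W"
  shows "\<exists>m. is_next S W m"
proof -
  have W: "finite W" "W \<noteq> {}" "W \<subseteq> S" using assms by (auto simp: convex_in_def intro: finite_subset[of _ S])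
  have ne: "S \<noteq> {}" using W by blast
  have above: "i < Max S" if "i \<in> W" for i
  proof -
    have "i \<le> Max S" using that W assms(1) by auto
    moreover have "i \<noteq> Max S" using that assms(3) by auto
    ultimately show ?thesis by simp
  qed
  let ?A = "{j\<in>S. \<forall>i\<in>W. i < j}"
  have "Max S \<in> ?A" using above ne assms(1) by simp
  then have m: "Min ?A \<in> ?A" using assms(1) by (intro Min_in) auto
  have "Min ?A \<le> j \<or> (\<forall>i\<in>W. j < i)" if j: "j \<in> S" "j \<notin> W" for j
  proof (cases "\<forall>i\<in>W. i < j")
    case True
    then show ?thesis using j assms(1) by auto
  next
    case False
    then obtain i where i: "i \<in> W" "j < i" using j by (metis nat_neq_iff)
    have "j < k" if "k \<in> W" for k
    proof (rule ccontr)
      assume "\<not> j < k"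
      with that j have "k < j" by (metis nat_neq_iff)
      then show False using assms(2) that i j unfolding convex_in_def by blast
    qed
    then show ?thesis by blast
  qed
  then have "is_next S W (Min ?A)" using m unfolding is_next_def by blast
  then show ?thesis ..
qed

lemma is_next_next_after:
  assumes "finite S" "convex_in S W" "Max S \<notin> W"
  shows "is_next S W (next_after S W)"
  using is_next_exists[OF assms] next_after_eqI[OF assms(1,2)] by auto

text \<open>A nonempty finite block attains its extremes, so the closed-interval condition in
  \<open>rec_block\<close> amounts to order convexity, which passes to smaller ambient sets.\<close>

lemma rec_block_iff:
  assumes "finite S" "partition_on S \<sigma>"
  shows "rec_block S \<sigma> W \<longleftrightarrow> W \<in> \<sigma> \<and> convex_in S W \<and> Max S \<notin> W"
proof (cases "W \<in> \<sigma>")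
  case True
  then have W: "W \<subseteq> S" "W \<noteq> {}" "finite W" using assms
    by (auto simp: partition_on_def intro: finite_subset[of _ S])
  have "(\<forall>j\<in>S. Min W \<le> j \<and> j \<le> Max W \<longrightarrow> j \<in> W) \<longleftrightarrow> convex_in S W"
  proof
    assume l: "\<forall>j\<in>S. Min W \<le> j \<and> j \<le> Max W \<longrightarrow> j \<in> W"
    have "j \<in> W" if "i \<in> W" "k \<in> W" "j \<in> S" "i < j" "j < k" for i j k
    proof -
      have "Min W \<le> i" "k \<le> Max W" using that W by auto
      then show ?thesis using l that by force
    qed
    then show "convex_in S W" unfolding convex_in_def using W by blast
  next
    assume r: "convex_in S W"
    show "\<forall>j\<in>S. Min W \<le> j \<and> j \<le> Max W \<longrightarrow> j \<in> W"
    proof clarify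
      fix j assume j: "j \<in> S" "Min W \<le> j" "j \<le> Max W"
      have "Min W \<in> W" "Max W \<in> W" using W by auto
      with r j show "j \<in> W" unfolding convex_in_def by (metis le_neq_implies_less)
    qed
  qed
  then show ?thesis using True by (auto simp: rec_block_def)
qed (auto simp: rec_block_def)

lemma partition_on_remove:
  assumes "partition_on S \<sigma>" "W \<in> \<sigma>"
  shows "partition_on (S - W) (\<sigma> - {W})"
  using assms unfolding partition_on_def disjoint_def by blast

lemma Max_diff:
  assumes "finite S" "S \<noteq> {}" "Max S \<notin> W"
  shows "Max (S - W) = Max S"
  using assms by (intro Max_eqI) auto

text \<open>\<open>W\<close> misses the last element of \<open>S\<close>, so that element is still
  the last one of \<open>S - W\<close>; convexity of \<open>W'\<close> survives in the smaller
  set.\<close>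

lemma rec_block_remove:
  assumes "finite S" "partition_on S \<sigma>" "rec_block S \<sigma> W" "rec_block S \<sigma> W'" "W \<noteq> W'"
  shows "rec_block (S - W) (\<sigma> - {W}) W'"
proof -
  note * = assms(3,4)[unfolded rec_block_iff[OF assms(1,2)]]
  have d: "W \<inter> W' = {}" using assms(2,5) * unfolding partition_on_def disjoint_def by blast
  have ne: "S \<noteq> {}" using * unfolding convex_in_def by blast
  have "convex_in (S - W) W'" using * d unfolding convex_in_def by blast
  then show ?thesis
    using * assms Max_diff[OF assms(1) ne, of W] partition_on_remove[OF assms(2), of W]
    by (subst rec_block_iff) auto
qed

lemma noncrossingD:
  "\<lbrakk>noncrossing \<sigma>; V \<in> \<sigma>; W \<in> \<sigma>; V \<noteq> W; a \<in> V; b \<in> W; c \<in> V; d \<in> W; a < b; b < c; c < d\<rbrakk> \<Longrightarrow> False"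
  unfolding noncrossing_def by metis

text \<open>Among the blocks without \<open>Max S\<close>, one of least spread
  \<open>Max X - Min X\<close> is an interval: a block through a gap of it would be nested inside
  it, hence have smaller spread and also avoid \<open>Max S\<close>.\<close>

lemma noncrossing_rec_block_exists:
  assumes "finite S" "partition_on S \<sigma>" "noncrossing \<sigma>" "\<sigma> \<noteq> {S}" "S \<noteq> {}"
  shows "\<exists>W. rec_block S \<sigma> W"
proof -
  have fin: "finite X" and ne: "X \<noteq> {}" and sub: "X \<subseteq> S" if "X \<in> \<sigma>" for X
    using that assms by (auto simp: partition_on_def intro: finite_subset[of _ S])
  have "\<exists>X. X \<in> \<sigma> \<and> Max S \<notin> X"
  proof (rule ccontr)
    assume a: "\<not> ?thesis"
    have "X = Y" if "X \<in> \<sigma>" "Y \<in> \<sigma>" for X Y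
      using a assms(2) that unfolding partition_on_def disjoint_def by blast
    moreover have "\<Union>\<sigma> = S" using assms(2) by (auto simp: partition_on_def)
    moreover from this assms(5) obtain X where "X \<in> \<sigma>" by blast
    ultimately have "\<sigma> = {X}" "\<Union>\<sigma> = S" by blast+
    then have "\<sigma> = {S}" by simp
    then show False using assms(4) by simp
  qed
  from ex_has_least_nat[of "\<lambda>X. X \<in> \<sigma> \<and> Max S \<notin> X" _ "\<lambda>X. Max X - Min X"] this
  obtain W where W: "W \<in> \<sigma>" "Max S \<notin> W"
    and least: "\<And>X. \<lbrakk>X \<in> \<sigma>; Max S \<notin> X\<rbrakk> \<Longrightarrow> Max W - Min W \<le> Max X - Min X"
    by blast
  note WW = fin[OF W(1)] ne[OF W(1)] sub[OF W(1)]
  have mm: "Min W \<in> W" "Max W \<in> W" using WW by auto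
  have "j \<in> W" if j: "j \<in> S" "Min W \<le> j" "j \<le> Max W" for j
  proof (rule ccontr)
    assume jW: "j \<notin> W"
    obtain X where X: "X \<in> \<sigma>" "j \<in> X" using j assms(2) by (auto simp: partition_on_def)
    have d: "X \<inter> W = {}" "X \<noteq> W" using X W jW assms(2) unfolding partition_on_def disjoint_def by blast+
    have jj: "Min W < j" "j < Max W" using j mm jW by (metis le_neq_implies_less)+
    \<comment> \<open>A point \<open>x\<close> left of \<open>Min W\<close> or right of
      \<open>Max W\<close> would form a crossing with \<open>Min W\<close>, \<open>j\<close> and
      \<open>Max W\<close>.\<close>
    have inside: "Min W < x \<and> x < Max W" if "x \<in> X" for x
    proof (rule ccontr)
      assume "\<not> ?thesis"
      moreover have "x \<noteq> Min W" "x \<noteq> Max W" using that d mm by auto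
      ultimately have "x < Min W \<or> Max W < x" by linarith
      then show False
        using noncrossingD[OF assms(3) X(1) W(1) d(2) that mm(1) X(2) mm(2)]
          noncrossingD[OF assms(3) W(1) X(1) d(2)[symmetric] mm(1) X(2) mm(2) that] jj
        by blast
    qed
    have "Min W < Min X" "Max X < Max W" "Min X \<le> Max X" using inside fin[OF X(1)] ne[OF X(1)] by auto
    then have "Max X - Min X < Max W - Min W" by linarith
    moreover have "Max S \<notin> X"
    proof
      assume "Max S \<in> X"
      then have "Max S < Max W" using inside by blast
      moreover have "Max W \<le> Max S" using WW mm assms(1) by auto
      ultimately show False by simp
    qed
    ultimately show False using least[OF X(1)] by simp
  qed
  then show ?thesis using W unfolding rec_block_def by blast
qed

section \<open>One step of the recursion for moments\<close>

definition absorb :: "('a::ring_1 \<Rightarrow> 'a) \<Rightarrow> nat set \<Rightarrow> nat set \<Rightarrow> (nat \<Rightarrow> 'a) \<Rightarrow> nat \<Rightarrow> 'a" where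
  "absorb E S W a = a(next_after S W := E (ordprod W a) * a (next_after S W))"

text \<open>This hides the choice operator: later proofs use only that some admissible block is
  removed. The block is chosen before the arguments are looked at, so one \<open>W\<close> serves
  all \<open>a\<close> simultaneously.\<close>

lemma phi_aux_Suc_cases:
  fixes E :: "'a::ring_1 \<Rightarrow> 'a"
  obtains (stop) "\<And>W. \<not> rec_block S \<sigma> W" "\<And>a. phi_aux E (Suc k) S \<sigma> a = E (ordprod S a)"
  | (step) W where "rec_block S \<sigma> W"
      "\<And>a. phi_aux E (Suc k) S \<sigma> a = phi_aux E k (S - W) (\<sigma> - {W}) (absorb E S W a)"
proof (cases "\<exists>W. rec_block S \<sigma> W")
  case True
  define W where "W = (SOME W. rec_block S \<sigma> W \<and> (\<forall>W'. rec_block S \<sigma> W' \<longrightarrow> Min W \<le> Min W'))"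
  have "\<exists>W. rec_block S \<sigma> W \<and> (\<forall>W'. rec_block S \<sigma> W' \<longrightarrow> Min W \<le> Min W')"
    using True ex_has_least_nat[of "rec_block S \<sigma>" _ Min] by blast
  from someI_ex[OF this] have "rec_block S \<sigma> W" unfolding W_def by blast
  then show ?thesis
    using True by (intro step[of W]) (auto simp: absorb_def W_def[symmetric] Let_def)
next
  case False
  then show ?thesis by (intro stop) auto
qed

text \<open>Arguments at positions of deleted blocks remain in the function but are never read
  again; this lemma allows them to be changed freely.\<close>

lemma phi_aux_cong:
  assumes "finite S" "partition_on S \<sigma>" "\<And>i. i \<in> S \<Longrightarrow> a i = b i"
  shows "phi_aux E k S \<sigma> a = phi_aux E k S \<sigma> b"
  using assms
proof (induction k arbitrary: S \<sigma> a b)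
  case 0
  then show ?case using ordprod_cong[of S a b] by simp
next
  case (Suc k)
  show ?case
  proof (rule phi_aux_Suc_cases[where E = E and k = k and S = S and \<sigma> = \<sigma>])
    assume "\<And>a. phi_aux E (Suc k) S \<sigma> a = E (ordprod S a)"
    then show ?thesis using ordprod_cong[of S a b] Suc.prems by simp
  next
    fix W assume W: "rec_block S \<sigma> W"
      and eq: "\<And>a. phi_aux E (Suc k) S \<sigma> a = phi_aux E k (S - W) (\<sigma> - {W}) (absorb E S W a)"
    note W' = W[unfolded rec_block_iff[OF Suc.prems(1,2)]]
    have "ordprod W a = ordprod W b" using Suc.prems W' by (intro ordprod_cong) (auto simp: convex_in_def)
    then show ?thesis unfolding eq using Suc.prems W' partition_on_remove[of S \<sigma> W]
      by (intro Suc.IH) (auto simp: absorb_def)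
  qed
qed

lemma rec_block_next:
  assumes "finite S" "partition_on S \<sigma>" "rec_block S \<sigma> W"
  obtains m where "is_next S W m" "next_after S W = m" "m \<notin> W" "m \<in> S"
  using is_next_next_after[of S W] assms rec_block_iff[OF assms(1,2), of W]
  by (auto simp: is_next_def)

section \<open>Independence of the order of removal\<close>

lemma convex_in_side:
  assumes "convex_in S V" "j \<in> S" "j \<notin> V"
  shows "(\<forall>i\<in>V. j < i) \<or> (\<forall>i\<in>V. i < j)"
proof (rule ccontr)
  assume "\<not> ?thesis"
  then obtain i k where "i \<in> V" "k \<in> V" "\<not> j < i" "\<not> k < j" by blast
  moreover from this assms have "i < j" "j < k" by (metis nat_neq_iff)+
  ultimately show False using assms unfolding convex_in_def by blast
qed

text \<open>Every point of one interval lies on one side of the other interval, so a single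
  comparison fixes the order of all pairs.\<close>

lemma convex_in_disjoint_order:
  assumes "convex_in S V" "convex_in S W" "V \<inter> W = {}"
  shows "(\<forall>i\<in>V. \<forall>j\<in>W. i < j) \<or> (\<forall>i\<in>V. \<forall>j\<in>W. j < i)"
proof -
  have V: "(\<forall>i\<in>V. j < i) \<or> (\<forall>i\<in>V. i < j)" if "j \<in> W" for j
    using that assms(2,3) unfolding convex_in_def by (intro convex_in_side[OF assms(1)]) blast+
  have W: "(\<forall>j\<in>W. i < j) \<or> (\<forall>j\<in>W. j < i)" if "i \<in> V" for i
    using that assms(1,3) unfolding convex_in_def by (intro convex_in_side[OF assms(2)]) blast+
  show ?thesis
  proof (rule disjCI)
    assume "\<not> (\<forall>i\<in>V. \<forall>j\<in>W. j < i)"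
    then obtain i0 j0 where "i0 \<in> V" "j0 \<in> W" "\<not> j0 < i0" by blast
    then have i0: "i0 \<in> V" "\<forall>j\<in>W. i0 < j" using W[of i0] by blast+
    show "\<forall>i\<in>V. \<forall>j\<in>W. i < j"
    proof (intro ballI)
      fix i j assume "i \<in> V" "j \<in> W"
      then show "i < j" using V[of j] i0 by (metis less_asym)
    qed
  qed
qed

lemma Diff_right_commute: "A - C - D = A - D - (C :: 'a set)" by blast

locale bimodule_expectation =
  fixes E :: "'a::ring_1 \<Rightarrow> 'a" and B :: "'a set"
  assumes E_add: "E (x + y) = E x + E y"
    and E_left: "b \<in> B \<Longrightarrow> E (b * x) = b * E x"
    and E_right: "b \<in> B \<Longrightarrow> E (x * b) = E x * b"
    and E_mem: "E x \<in> B"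
begin

lemma phi_aux_mem: "phi_aux E k S \<sigma> a \<in> B"
  by (induction k arbitrary: S \<sigma> a) (auto simp: E_mem Let_def)

text \<open>The only interaction arises when the right neighbour \<open>v\<close> of
  \<open>V\<close> lies in \<open>W\<close>. Then either order of removal leaves the moment of
  \<open>V\<close> times the moment of \<open>W\<close> in front of \<open>a w\<close>.\<close>

lemma absorb_commute_ordered:
  assumes "finite S" "partition_on S \<sigma>" "rec_block S \<sigma> V" "rec_block S \<sigma> W"
    and less: "\<And>i j. \<lbrakk>i \<in> V; j \<in> W\<rbrakk> \<Longrightarrow> i < j"
    and i: "i \<in> S - V - W"
  shows "absorb E (S - V) W (absorb E S V a) i = absorb E (S - W) V (absorb E S W a) i"
proof -
  note VW = assms(3,4)[unfolded rec_block_iff[OF assms(1,2)]]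
  have ne: "V \<noteq> {}" "W \<noteq> {}" using VW by (auto simp: convex_in_def)
  have disj: "V \<inter> W = {}" using less by blast
  have "W \<subseteq> S" using VW unfolding convex_in_def by blast
  then have fin: "finite W" using assms(1) by (rule finite_subset)
  have cv: "convex_in (S - V) W" "convex_in (S - W) V"
    using VW disj unfolding convex_in_def by blast+
  obtain v where v: "is_next S V v" "next_after S V = v" "v \<notin> V" "v \<in> S"
    by (rule rec_block_next[OF assms(1-3)])
  obtain w where w: "is_next S W w" "next_after S W = w" "w \<notin> W" "w \<in> S"
    by (rule rec_block_next[OF assms(1,2,4)])
  have "w \<notin> V" using w less ne unfolding is_next_def by (metis all_not_in_conv less_asym)
  then have "is_next (S - V) W w" using w unfolding is_next_def by blast
  with cv(1) have nw: "next_after (S - V) W = w" using assms(1) by (intro next_after_eqI) auto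
  have vle: "v \<le> j" if "j \<in> W" for j
  proof -
    have "j \<in> S" "j \<notin> V" using that VW disj unfolding convex_in_def by blast+
    then have "v \<le> j \<or> (\<forall>i\<in>V. j < i)" using v unfolding is_next_def by blast
    then show ?thesis using less that ne by (metis all_not_in_conv less_asym)
  qed
  have ordV: "ordprod V (absorb E S W a) = ordprod V a"
    using \<open>w \<notin> V\<close> by (intro ordprod_cong) (auto simp: absorb_def w(2))
  show ?thesis
  proof (cases "v \<in> W")
    case True
    \<comment> \<open>\<open>W\<close> begins at the neighbour of \<open>V\<close>, so after the
      deletion of \<open>W\<close> its right neighbour is inherited by \<open>V\<close>.\<close>
    have "is_next (S - W) V w"
      unfolding is_next_def
    proof (intro conjI ballI impI)
      show "w \<in> S - W" using w by simp
      show "i < w" if "i \<in> V" for i using that less[OF that True] w True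
        unfolding is_next_def by (metis less_trans)
      show "w \<le> j \<or> (\<forall>i\<in>V. j < i)" if "j \<in> S - W" "j \<notin> V" for j
      proof -
        have "w \<le> j \<or> (\<forall>i\<in>W. j < i)" "v \<le> j \<or> (\<forall>i\<in>V. j < i)"
          using that v w unfolding is_next_def by blast+
        then show ?thesis using True by auto
      qed
    qed
    with cv(2) have nv: "next_after (S - W) V = w" using assms(1) by (intro next_after_eqI) auto
    \<comment> \<open>\<open>v\<close> is the first element of \<open>W\<close>, so the moment of
      \<open>V\<close> stands in front of the product and leaves \<open>E\<close> by left linearity
      over \<open>B\<close>.\<close>
    have "ordprod W (a(v := E (ordprod V a) * a v)) = E (ordprod V a) * ordprod W a"
      using True vle fin by (intro ordprod_upd_first) auto
    then have "E (ordprod W (absorb E S V a)) = E (ordprod V a) * E (ordprod W a)"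
      by (simp add: absorb_def v(2) E_left E_mem)
    moreover have "i \<noteq> v" "w \<noteq> v" using True i w by auto
    ultimately show ?thesis
      using ordV by (simp add: absorb_def v(2) w(2) nv nw mult.assoc)
  next
    case False
    \<comment> \<open>Here \<open>v\<close> lies strictly between \<open>V\<close> and
      \<open>W\<close>; the two removals change different entries, and neither affects the product
      over the other block.\<close>
    then have "is_next (S - W) V v" using v unfolding is_next_def by blast
    with cv(2) have nv: "next_after (S - W) V = v" using assms(1) by (intro next_after_eqI) auto
    have "ordprod W (absorb E S V a) = ordprod W a"
      using False by (intro ordprod_cong) (auto simp: absorb_def v(2))
    moreover have "v \<noteq> w" using vle w ne unfolding is_next_def by fastforce
    ultimately show ?thesis
      using ordV by (simp add: absorb_def v(2) w(2) nv nw)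
  qed
qed

lemma absorb_commute:
  assumes "finite S" "partition_on S \<sigma>" "rec_block S \<sigma> V" "rec_block S \<sigma> W" "V \<noteq> W"
    and "i \<in> S - V - W"
  shows "absorb E (S - V) W (absorb E S V a) i = absorb E (S - W) V (absorb E S W a) i"
proof -
  note VW = assms(3,4)[unfolded rec_block_iff[OF assms(1,2)]]
  have "V \<inter> W = {}" using VW assms(2,5) unfolding partition_on_def disjoint_def by blast
  with VW have "(\<forall>i\<in>V. \<forall>j\<in>W. i < j) \<or> (\<forall>i\<in>V. \<forall>j\<in>W. j < i)"
    by (intro convex_in_disjoint_order[of S]) auto
  then show ?thesis
    using absorb_commute_ordered[OF assms(1-4), of i a]
      absorb_commute_ordered[OF assms(1,2,4,3), of i a] assms(6) by auto
qed

text \<open>An admissible block always leaves a second block behind, namely the one through the last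
  element of \<open>S\<close>; this guarantees that the recursion has fuel left.\<close>

lemma rec_block_card:
  assumes "finite S" "partition_on S \<sigma>" "rec_block S \<sigma> W"
  obtains X where "X \<in> \<sigma>" "X \<noteq> W" "Max S \<in> X"
proof -
  note W = assms(3)[unfolded rec_block_iff[OF assms(1,2)]]
  then have "Max S \<in> S" using assms(1) by (intro Max_in) (auto simp: convex_in_def)
  then obtain X where "X \<in> \<sigma>" "Max S \<in> X" using assms(2) by (auto simp: partition_on_def)
  then show ?thesis using W that by blast
qed

text \<open>Removing two interval blocks commutes, hence the value does not depend on which
  admissible block is removed first.\<close>

lemma phi_aux_remove:
  assumes "finite S" "partition_on S \<sigma>" "rec_block S \<sigma> W" "card \<sigma> = Suc (Suc k)"
  shows "phi_aux E (Suc k) S \<sigma> a = phi_aux E k (S - W) (\<sigma> - {W}) (absorb E S W a)"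
  using assms
proof (induction k arbitrary: S \<sigma> a W)
  case (0 S \<sigma> a W)
  obtain V where V: "rec_block S \<sigma> V"
    and eq: "phi_aux E (Suc 0) S \<sigma> a = phi_aux E 0 (S - V) (\<sigma> - {V}) (absorb E S V a)"
    using phi_aux_Suc_cases[of S \<sigma> E 0] 0 by metis
  \<comment> \<open>With two blocks only one can avoid \<open>Max S\<close>: two admissible blocks
    and the block through \<open>Max S\<close> would make three.\<close>
  have "V = W"
  proof (rule ccontr)
    assume ne: "V \<noteq> W"
    note VW = V[unfolded rec_block_iff[OF 0(1,2)]] 0(3)[unfolded rec_block_iff[OF 0(1,2)]]
    obtain X where X: "X \<in> \<sigma>" "X \<noteq> W" "Max S \<in> X" 
      by (rule rec_block_card[OF 0(1-3)])
    then have "V \<noteq> X" using VW by blast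
    then have "card {V, W, X} = 3" using X ne by simp
    moreover have "{V, W, X} \<subseteq> \<sigma>" using VW X by blast
    ultimately have "3 \<le> card \<sigma>" using card_mono[of \<sigma> "{V, W, X}"] 0 card.infinite[of \<sigma>] by fastforce
    then show False using 0 by simp
  qed
  then show ?case using eq by simp
next
  case (Suc k S \<sigma> a W)
  obtain V where V: "rec_block S \<sigma> V"
    and eq: "phi_aux E (Suc (Suc k)) S \<sigma> a = phi_aux E (Suc k) (S - V) (\<sigma> - {V}) (absorb E S V a)"
    using phi_aux_Suc_cases[of S \<sigma> E "Suc k"] Suc.prems by metis
  show ?case
  proof (cases "V = W")
    case True
    then show ?thesis using eq by simp
  next
    case False
    note VW = V[unfolded rec_block_iff[OF Suc.prems(1,2)]]
      Suc.prems(3)[unfolded rec_block_iff[OF Suc.prems(1,2)]]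
    have part: "partition_on (S - V) (\<sigma> - {V})" "partition_on (S - W) (\<sigma> - {W})"
      using VW Suc.prems(2) partition_on_remove by blast+
    have part2: "partition_on (S - V - W) (\<sigma> - {V} - {W})"
      using VW False part(1) partition_on_remove by blast
    have card: "card (\<sigma> - {V}) = Suc (Suc k)" "card (\<sigma> - {W}) = Suc (Suc k)"
      using VW Suc.prems(4) by (simp_all add: card_Diff_singleton)
    \<comment> \<open>\<open>V\<close> is the block chosen by the recursion. The induction
      hypothesis removes \<open>W\<close> after \<open>V\<close>, commutation exchanges the two, and
      the induction hypothesis read backwards restores \<open>V\<close>.\<close>
    have "phi_aux E (Suc k) (S - V) (\<sigma> - {V}) (absorb E S V a)
        = phi_aux E k (S - V - W) (\<sigma> - {V} - {W}) (absorb E (S - V) W (absorb E S V a))"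
      using Suc.prems V False part card by (intro Suc.IH rec_block_remove) auto
    also have "\<dots> = phi_aux E k (S - V - W) (\<sigma> - {V} - {W}) (absorb E (S - W) V (absorb E S W a))"
      using Suc.prems(1-3) V False part2 by (intro phi_aux_cong absorb_commute) auto
    also have "\<dots> = phi_aux E k (S - W - V) (\<sigma> - {W} - {V}) (absorb E (S - W) V (absorb E S W a))"
      by (simp add: Diff_right_commute)
    also have "\<dots> = phi_aux E (Suc k) (S - W) (\<sigma> - {W}) (absorb E S W a)"
      using Suc.prems V False part card by (intro Suc.IH[symmetric] rec_block_remove) auto
    finally show ?thesis using eq by simp
  qed
qed

text \<open>There are at least two blocks, so the fuel \<open>card \<sigma> - 1\<close> is positive,
  and one removal lowers it to exactly the fuel that belongs to the smaller partition.\<close>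

lemma Phi_remove:
  assumes "finite S" "partition_on S \<sigma>" "rec_block S \<sigma> W"
  shows "Phi E S \<sigma> a = Phi E (S - W) (\<sigma> - {W}) (absorb E S W a)"
proof -
  have W: "W \<in> \<sigma>" using assms by (simp add: rec_block_def)
  have fin: "finite \<sigma>" using assms finite_elements by blast
  obtain X where X: "X \<in> \<sigma>" "X \<noteq> W" by (rule rec_block_card[OF assms])
  then have "card {X, W} \<le> card \<sigma>" using W fin by (intro card_mono) auto
  then have "Suc (Suc 0) \<le> card \<sigma>" using X by simp
  then obtain k where k: "card \<sigma> = Suc (Suc k)" by (metis Suc_le_D Suc_le_mono)
  then show ?thesis using phi_aux_remove[OF assms k] W by (simp add: Phi_def card_Diff_singleton)
qed

lemma Phi_singleton: "Phi E S {S} a = E (ordprod S a)"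
  by (simp add: Phi_def)

lemma Phi_mem: "Phi E S \<sigma> a \<in> B"
  by (simp add: Phi_def phi_aux_mem)

lemma Phi_cong:
  "\<lbrakk>finite S; partition_on S \<sigma>; \<And>i. i \<in> S \<Longrightarrow> a i = b i\<rbrakk> \<Longrightarrow> Phi E S \<sigma> a = Phi E S \<sigma> b"
  unfolding Phi_def by (rule phi_aux_cong)

end

section \<open>Bimodule properties of the moments\<close>

lemma partition_on_Un:
  "\<lbrakk>partition_on S \<sigma>; partition_on T \<tau>; S \<inter> T = {}\<rbrakk> \<Longrightarrow> partition_on (S \<union> T) (\<sigma> \<union> \<tau>)"
  unfolding partition_on_def by (auto intro!: disjoint_union)

lemma noncrossing_subset: "\<lbrakk>noncrossing \<sigma>; \<tau> \<subseteq> \<sigma>\<rbrakk> \<Longrightarrow> noncrossing \<tau>"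
  unfolding noncrossing_def by (meson subsetD)

context bimodule_expectation
begin

text \<open>In one step the entry at \<open>i\<close> either enters the moment of \<open>W\<close>
  and so becomes a left factor at \<open>m\<close>, or receives that moment as a left factor, or
  stays untouched. Each time the induction hypothesis applies, at \<open>m\<close> in the first case
  and at \<open>i\<close> otherwise.\<close>

lemma phi_aux_additive:
  assumes "finite S" "partition_on S \<sigma>" "i \<in> S"
  shows "phi_aux E k S \<sigma> (a(i := x + y)) = phi_aux E k S \<sigma> (a(i := x)) + phi_aux E k S \<sigma> (a(i := y))"
  using assms
proof (induction k arbitrary: S \<sigma> a i x y)
  case (0 S \<sigma> a i x y)
  then show ?case unfolding phi_aux.simps by (simp add: ordprod_upd E_add distrib_left distrib_right)
next
  case (Suc k S \<sigma> a i x y)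
  show ?case
  proof (cases rule: phi_aux_Suc_cases[where E = E and k = k and S = S and \<sigma> = \<sigma>])
    case stop
    show ?thesis unfolding stop(2) using Suc.prems by (simp add: ordprod_upd E_add distrib_left distrib_right)
  next
    case (step W)
    note W = step(1)[unfolded rec_block_iff[OF Suc.prems(1,2)]]
    have fin: "finite (S - W)" "finite W" using W Suc.prems(1) by (auto simp: convex_in_def finite_subset)
    have part: "partition_on (S - W) (\<sigma> - {W})" using W Suc.prems(2) partition_on_remove by blast
    obtain m where m: "is_next S W m" "next_after S W = m" "m \<notin> W" "m \<in> S"
      by (rule rec_block_next[OF Suc.prems(1,2) step(1)])
    show ?thesis
    proof (cases "i \<in> W")
      case True
      let ?u = "\<lambda>z. E (ordprod W (a(i := z)))"
      have u: "?u (x + y) = ?u x + ?u y"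
        using True fin by (simp add: ordprod_upd E_add distrib_left distrib_right)
      \<comment> \<open>Position \<open>i\<close> is deleted with \<open>W\<close>, so its entry may
        be reset to \<open>a i\<close>; only the new entry at \<open>m\<close> still depends on
        \<open>z\<close>.\<close>
      have eq: "phi_aux E (Suc k) S \<sigma> (a(i := z)) = phi_aux E k (S - W) (\<sigma> - {W}) (a(m := ?u z * a m))" for z
        unfolding step(2) using True m
        by (intro phi_aux_cong[OF fin(1) part]) (auto simp: absorb_def)
      show ?thesis unfolding eq u distrib_right using m by (intro Suc.IH[OF fin(1) part]) auto
    next
      case False
      have ord: "ordprod W (a(i := z)) = ordprod W a" for z
        using False by (intro ordprod_cong) auto
      show ?thesis
      proof (cases "i = m")
        case True
        have ab: "absorb E S W (a(i := z)) = a(i := E (ordprod W a) * z)" for z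
          using True m ord by (simp add: absorb_def)
        show ?thesis unfolding step(2) ab distrib_left
          using False Suc.prems by (intro Suc.IH[OF fin(1) part]) auto
      next
        case im: False
        have ab: "absorb E S W (a(i := z)) = (absorb E S W a)(i := z)" for z
          using im m ord by (auto simp: absorb_def)
        show ?thesis unfolding step(2) ab
          using False Suc.prems by (intro Suc.IH[OF fin(1) part]) auto
      qed
    qed
  qed
qed

text \<open>The block containing \<open>j\<close> is pulled into its right neighbour, where the factor \<open>b\<close>
  reappears on the left; so the statement has to be proved for all adjacent pairs at once.\<close>

lemma phi_aux_shift:
  assumes "finite S" "partition_on S \<sigma>" "i \<in> S" "j \<in> S" "i < j"
    and "\<And>k. k \<in> S \<Longrightarrow> k \<le> i \<or> j \<le> k" and b: "b \<in> B"
  shows "phi_aux E k S \<sigma> (a(j := b * a j)) = phi_aux E k S \<sigma> (a(i := a i * b))"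
  using assms(1-6)
proof (induction k arbitrary: S \<sigma> a i j)
  case (0 S \<sigma> a i j)
  then show ?case unfolding phi_aux.simps using ordprod_shift[of S i j a b] by simp
next
  case (Suc k S \<sigma> a i j)
  show ?case
  proof (cases rule: phi_aux_Suc_cases[where E = E and k = k and S = S and \<sigma> = \<sigma>])
    case stop
    show ?thesis unfolding stop(2) using Suc.prems ordprod_shift[of S i j a b] by simp
  next
    case (step W)
    note W = step(1)[unfolded rec_block_iff[OF Suc.prems(1,2)]]
    have fin: "finite (S - W)" "finite W" using W Suc.prems(1) by (auto simp: convex_in_def finite_subset)
    have sub: "W \<subseteq> S" and ne: "W \<noteq> {}" using W unfolding convex_in_def by blast+
    have part: "partition_on (S - W) (\<sigma> - {W})" using W Suc.prems(2) partition_on_remove by blast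
    obtain m where m: "is_next S W m" "next_after S W = m" "m \<notin> W" "m \<in> S"
      by (rule rec_block_next[OF Suc.prems(1,2) step(1)])
    have mgt: "w < m" if "w \<in> W" for w using m that unfolding is_next_def by blast
    have mle: "m \<le> w \<or> (\<forall>v\<in>W. w < v)" if "w \<in> S" "w \<notin> W" for w
      using m that unfolding is_next_def by blast
    consider "i \<in> W" "j \<in> W" | "i \<in> W" "j \<notin> W" | "i \<notin> W" "j \<in> W" | "i \<notin> W" "j \<notin> W" by blast
    then show ?thesis
    proof cases
      case 1
      have "ordprod W (a(j := b * a j)) = ordprod W (a(i := a i * b))"
        using 1 fin sub Suc.prems by (intro ordprod_shift) auto
      then show ?thesis unfolding step(2) using 1 m
        by (intro phi_aux_cong[OF fin(1) part]) (auto simp: absorb_def)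
    next
      case 2
      \<comment> \<open>\<open>i\<close> is the last element of \<open>W\<close> and
        \<open>j\<close> its right neighbour: \<open>b\<close> leaves \<open>E\<close> on the right
        and stands directly before \<open>a j\<close>.\<close>
      have "m \<le> j" using mle[of j] 2 Suc.prems by force
      moreover have "j \<le> m" using Suc.prems(6)[of m] m mgt[of i] 2 by auto
      ultimately have mj: "m = j" by simp
      have "ordprod W (a(i := a i * b)) = ordprod W a * b"
        using 2 fin sub Suc.prems(6) mgt mj by (intro ordprod_upd_last) fastforce+
      moreover have "ordprod W (a(j := b * a j)) = ordprod W a"
        using 2 by (intro ordprod_cong) auto
      ultimately show ?thesis unfolding step(2) using 2 m mj b
        by (intro phi_aux_cong[OF fin(1) part]) (auto simp: absorb_def E_right mult.assoc)
    next
      case 3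
      \<comment> \<open>A point of \<open>W\<close> before \<open>j\<close> would lie before
        \<open>i\<close>, and convexity would then put \<open>i\<close> into
        \<open>W\<close>.\<close>
      have first: "j \<le> w" if "w \<in> W" for w
      proof (rule ccontr)
        assume "\<not> j \<le> w"
        then have "w \<le> i" using Suc.prems(6)[of w] that sub by auto
        moreover have "w \<noteq> i" using that 3 by auto
        ultimately have "i \<in> W" using W that 3 Suc.prems(3,5) unfolding convex_in_def
          by (metis le_neq_implies_less)
        then show False using 3 by simp
      qed
      have im: "i < m" using mgt[of j] 3 Suc.prems(5) by auto
      \<comment> \<open>After the deletion of \<open>W\<close> the positions \<open>i\<close> and
        \<open>m\<close> are adjacent, so the induction hypothesis carries \<open>b\<close> from
        \<open>m\<close> back to \<open>i\<close>.\<close>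
      have adj: "w \<le> i \<or> m \<le> w" if "w \<in> S - W" for w
        using mle[of w] Suc.prems(6)[of w] 3 that by fastforce
      have "ordprod W (a(j := b * a j)) = b * ordprod W a"
        using 3 fin first by (intro ordprod_upd_first) auto
      then have "phi_aux E (Suc k) S \<sigma> (a(j := b * a j))
          = phi_aux E k (S - W) (\<sigma> - {W}) ((absorb E S W a)(m := b * absorb E S W a m))"
        unfolding step(2) using 3 m b
        by (intro phi_aux_cong[OF fin(1) part]) (auto simp: absorb_def E_left mult.assoc)
      also have "\<dots> = phi_aux E k (S - W) (\<sigma> - {W}) ((absorb E S W a)(i := absorb E S W a i * b))"
        using Suc.prems 3 m im adj by (intro Suc.IH[OF fin(1) part]) auto
      also have "(absorb E S W a)(i := absorb E S W a i * b) = absorb E S W (a(i := a i * b))"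
      proof -
        have "ordprod W (a(i := a i * b)) = ordprod W a" using 3 by (intro ordprod_cong) auto
        then show ?thesis using im m by (auto simp: absorb_def)
      qed
      finally show ?thesis unfolding step(2) .
    next
      case 4
      obtain w where w: "w \<in> W" using ne by blast
      \<comment> \<open>If \<open>j\<close> were the right neighbour of \<open>W\<close>, then
        \<open>W\<close> would lie strictly between the adjacent positions \<open>i\<close> and
        \<open>j\<close>.\<close>
      have mj: "m \<noteq> j"
      proof
        assume "m = j"
        then have "i < w" "w < j" using mle[of i] mgt[of w] w 4 Suc.prems(3,5) by auto
        then show False using Suc.prems(6)[of w] w sub by auto
      qed
      have "ordprod W (a(i := a i * b)) = ordprod W a" "ordprod W (a(j := b * a j)) = ordprod W a"
        using 4 by (auto intro!: ordprod_cong)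
      then have ab: "absorb E S W (a(j := b * a j)) = (absorb E S W a)(j := b * absorb E S W a j)"
        "absorb E S W (a(i := a i * b)) = (absorb E S W a)(i := absorb E S W a i * b)"
        using mj m by (auto simp: absorb_def mult.assoc fun_eq_iff)
      show ?thesis unfolding step(2) ab
        using Suc.prems 4 by (intro Suc.IH[OF fin(1) part]) auto
    qed
  qed
qed

text \<open>If the first position belongs to the removed block, \<open>b\<close> leaves its moment
  on the left and reappears in front at \<open>m\<close>, which is then the first position of
  \<open>S - W\<close>; otherwise the first position stays where it is.\<close>

lemma phi_aux_mult_first:
  assumes "finite S" "partition_on S \<sigma>" "i \<in> S" "\<And>j. j \<in> S \<Longrightarrow> i \<le> j" and b: "b \<in> B"
  shows "phi_aux E k S \<sigma> (a(i := b * a i)) = b * phi_aux E k S \<sigma> a"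
  using assms(1-4)
proof (induction k arbitrary: S \<sigma> a i)
  case (0 S \<sigma> a i)
  then show ?case unfolding phi_aux.simps using ordprod_upd_first[of S i a b] b by (simp add: E_left)
next
  case (Suc k S \<sigma> a i)
  show ?case
  proof (cases rule: phi_aux_Suc_cases[where E = E and k = k and S = S and \<sigma> = \<sigma>])
    case stop
    show ?thesis unfolding stop(2) using Suc.prems ordprod_upd_first[of S i a b] b by (simp add: E_left)
  next
    case (step W)
    note W = step(1)[unfolded rec_block_iff[OF Suc.prems(1,2)]]
    have fin: "finite (S - W)" "finite W" using W Suc.prems(1) by (auto simp: convex_in_def finite_subset)
    have sub: "W \<subseteq> S" and ne: "W \<noteq> {}" using W unfolding convex_in_def by blast+
    have part: "partition_on (S - W) (\<sigma> - {W})" using W Suc.prems(2) partition_on_remove by blast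
    obtain m where m: "is_next S W m" "next_after S W = m" "m \<notin> W" "m \<in> S"
      by (rule rec_block_next[OF Suc.prems(1,2) step(1)])
    have mgt: "w < m" if "w \<in> W" for w using m that unfolding is_next_def by blast
    show ?thesis
    proof (cases "i \<in> W")
      case True
      have first: "m \<le> w" if "w \<in> S - W" for w
        using m that True Suc.prems(4)[of w] unfolding is_next_def by fastforce
      have "ordprod W (a(i := b * a i)) = b * ordprod W a"
        using True fin sub Suc.prems(4) by (intro ordprod_upd_first) auto
      then have "phi_aux E (Suc k) S \<sigma> (a(i := b * a i))
          = phi_aux E k (S - W) (\<sigma> - {W}) ((absorb E S W a)(m := b * absorb E S W a m))"
        unfolding step(2) using True m b
        by (intro phi_aux_cong[OF fin(1) part]) (auto simp: absorb_def E_left mult.assoc)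
      also have "\<dots> = b * phi_aux E k (S - W) (\<sigma> - {W}) (absorb E S W a)"
        using m first by (intro Suc.IH[OF fin(1) part]) auto
      finally show ?thesis unfolding step(2) .
    next
      case False
      have "i \<noteq> m" using ne mgt Suc.prems(4) sub by fastforce
      moreover have "ordprod W (a(i := b * a i)) = ordprod W a" using False by (intro ordprod_cong) auto
      ultimately have ab: "absorb E S W (a(i := b * a i)) = (absorb E S W a)(i := b * absorb E S W a i)"
        using m by (auto simp: absorb_def)
      show ?thesis unfolding step(2) ab using Suc.prems False
        by (intro Suc.IH[OF fin(1) part]) auto
    qed
  qed
qed

end

section \<open>Moments of a partition restricted to an interval\<close>

lemma partition_on_disjoint_notin:
  assumes "partition_on S \<sigma>" "partition_on T \<tau>" "S \<inter> T = {}" "X \<in> \<sigma>"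
  shows "X \<notin> \<tau>"
proof
  assume "X \<in> \<tau>"
  then have "X \<subseteq> S" "X \<subseteq> T" "X \<noteq> {}" using assms by (auto simp: partition_on_def)
  then show False using assms(3) by blast
qed

text \<open>A point outside the interval \<open>V\<close> lies on one side of all of
  \<open>V\<close>, so it cannot come between \<open>W\<close> and its neighbour inside
  \<open>V\<close>.\<close>

lemma is_next_inside:
  assumes "convex_in S V" "is_next V W w" "W \<subseteq> V"
  shows "is_next S W w"
  unfolding is_next_def
proof (intro conjI ballI impI)
  show "w \<in> S" using assms unfolding is_next_def convex_in_def by blast
  show "i < w" if "i \<in> W" for i using that assms unfolding is_next_def by blast
  show "w \<le> j \<or> (\<forall>i\<in>W. j < i)" if j: "j \<in> S" "j \<notin> W" for j
  proof (cases "j \<in> V")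
    case True
    then show ?thesis using j assms unfolding is_next_def by blast
  next
    case False
    have "w \<in> V" using assms unfolding is_next_def by blast
    then show ?thesis using convex_in_side[OF assms(1) j(1) False] assms(3) by (meson less_imp_le subsetD)
  qed
qed

lemma convex_in_inside: "\<lbrakk>convex_in S V; convex_in V W\<rbrakk> \<Longrightarrow> convex_in S W"
  unfolding convex_in_def by (meson subsetD subset_trans)

context bimodule_expectation
begin

text \<open>Admissible blocks of \<rho> are admissible in \<open>S\<close> too and have the same
  right neighbour there. Removing them one at a time reduces to \<rho> with the single block
  \<open>V\<close>, whose moment goes to \<open>m\<close>.\<close>

lemma Phi_interval_right:
  assumes "finite S" "convex_in S V" "Max S \<notin> V" "partition_on V \<rho>" "noncrossing \<rho>"
    and "partition_on (S - V) \<sigma>" "is_next S V m"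
  shows "Phi E S (\<sigma> \<union> \<rho>) a = Phi E (S - V) \<sigma> (a(m := Phi E V \<rho> a * a m))"
  using assms
proof (induction "card V" arbitrary: S V \<rho> a rule: less_induct)
  case (less V S \<rho> a)
  note prems = less.prems
  have V: "V \<noteq> {}" "V \<subseteq> S" using prems(2) unfolding convex_in_def by blast+
  then have finV: "finite V" using prems(1) finite_subset by blast
  have part: "partition_on S (\<sigma> \<union> \<rho>)"
    using partition_on_Un[OF prems(6,4)] Int_commute[of "S - V" V] V by (simp add: Un_absorb2)
  have disj: "X \<notin> \<sigma>" if "X \<in> \<rho>" for X
    using partition_on_disjoint_notin[OF prems(4,6) Diff_disjoint that] .
  show ?case
  proof (cases "\<rho> = {V}")
    case True
    have "rec_block S (\<sigma> \<union> \<rho>) V"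
      using prems True part by (subst rec_block_iff) auto
    then have "Phi E S (\<sigma> \<union> \<rho>) a = Phi E (S - V) ((\<sigma> \<union> \<rho>) - {V}) (absorb E S V a)"
      using Phi_remove prems(1) part by blast
    moreover have "(\<sigma> \<union> \<rho>) - {V} = \<sigma>" using disj True by blast
    moreover have "next_after S V = m" using next_after_eqI prems by blast
    ultimately show ?thesis using True by (simp add: Phi_singleton absorb_def)
  next
    case False
    then obtain W where W: "rec_block V \<rho> W"
      using noncrossing_rec_block_exists finV prems(4,5) V(1) by blast
    note WV = W[unfolded rec_block_iff[OF finV prems(4)]]
    have sub: "W \<subseteq> V" "W \<noteq> {}" using WV unfolding convex_in_def by blast+
    obtain w where w: "is_next V W w" "next_after V W = w" "w \<notin> W" "w \<in> V"
      by (rule rec_block_next[OF finV prems(4) W])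
    have cS: "convex_in S W" using convex_in_inside prems(2) WV by blast
    have nS: "next_after S W = w"
      using is_next_inside[OF prems(2) w(1) sub(1)] cS prems(1) by (intro next_after_eqI)
    have rS: "rec_block S (\<sigma> \<union> \<rho>) W"
      using prems(3) sub cS WV by (subst rec_block_iff[OF prems(1) part]) auto
    have eqs: "(\<sigma> \<union> \<rho>) - {W} = \<sigma> \<union> (\<rho> - {W})" "S - W - (V - W) = S - V"
      using disj WV sub by blast+
    have mW: "m \<notin> V" "m \<in> S" using prems(7) unfolding is_next_def by blast+
    let ?a = "absorb E S W a"
    have abs: "absorb E V W a = ?a" by (simp add: absorb_def nS w(2))
    have "Phi E S (\<sigma> \<union> \<rho>) a = Phi E (S - W) (\<sigma> \<union> (\<rho> - {W})) ?a"
      using Phi_remove[OF prems(1) part rS] eqs(1) by simp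
    \<comment> \<open>\<open>V - W\<close> is again an interval of \<open>S - W\<close>, with the
      same right neighbour \<open>m\<close>.\<close>
    also have "\<dots> = Phi E (S - W - (V - W)) \<sigma> (?a(m := Phi E (V - W) (\<rho> - {W}) ?a * ?a m))"
    proof (rule less.hyps)
      show "card (V - W) < card V" using sub finV by (intro psubset_card_mono) auto
      show "finite (S - W)" using prems(1) by simp
      show "convex_in (S - W) (V - W)" using prems(2) w sub unfolding convex_in_def by blast
      have "S \<noteq> {}" "Max S \<notin> W" using prems(3) V sub by blast+
      then show "Max (S - W) \<notin> V - W" using prems(1,3) by (simp add: Max_diff)
      show "partition_on (V - W) (\<rho> - {W})" using WV prems(4) partition_on_remove by blast
      show "noncrossing (\<rho> - {W})" using prems(5) noncrossing_subset by blast
      show "partition_on (S - W - (V - W)) \<sigma>" using prems(6) eqs by simp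
      show "is_next (S - W) (V - W) m" using prems(7) mW sub unfolding is_next_def by blast
    qed
    also have "\<dots> = Phi E (S - V) \<sigma> (a(m := Phi E V \<rho> a * a m))"
    proof -
      have "Phi E V \<rho> a = Phi E (V - W) (\<rho> - {W}) ?a"
        using Phi_remove[OF finV prems(4) W] abs by simp
      \<comment> \<open>The absorbed moment was placed at \<open>w\<close>, which belongs to
        \<open>V\<close>.\<close>
      moreover have "?a i = a i" if "i \<in> S - V" for i
        using that w(4) nS by (auto simp: absorb_def)
      ultimately show ?thesis unfolding eqs using prems(1,6) mW
        by (intro Phi_cong) auto
    qed
    finally show ?thesis .
  qed
qed

lemma Phi_shift:
  assumes "finite S" "partition_on S \<sigma>" "i \<in> S" "j \<in> S" "i < j"
    and "\<And>k. k \<in> S \<Longrightarrow> k \<le> i \<or> j \<le> k" and "b \<in> B"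
  shows "Phi E S \<sigma> (a(j := b * a j)) = Phi E S \<sigma> (a(i := a i * b))"
  unfolding Phi_def using assms by (rule phi_aux_shift)

text \<open>\<open>V\<close> ends the set and has no right neighbour to absorb its moment, so the
  blocks of \<sigma> are removed instead, until a single one remains.\<close>

lemma Phi_interval_last:
  assumes "finite S" "finite V" "S \<noteq> {}" "V \<noteq> {}" "\<And>i j. \<lbrakk>i \<in> S; j \<in> V\<rbrakk> \<Longrightarrow> i < j"
    and "partition_on S \<sigma>" "noncrossing \<sigma>" "partition_on V \<rho>"
  shows "Phi E (S \<union> V) (\<sigma> \<union> \<rho>) a = Phi E S \<sigma> (a(Max S := a (Max S) * Phi E V \<rho> a))"
  using assms
proof (induction "card S" arbitrary: S \<sigma> a rule: less_induct)
  case (less S \<sigma> a)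
  note prems = less.prems
  have SV: "S \<inter> V = {}" using prems(5) by blast
  have fin: "finite (S \<union> V)" using prems by simp
  have part: "partition_on (S \<union> V) (\<sigma> \<union> \<rho>)" using partition_on_Un prems(6,8) SV by blast
  have disj: "X \<notin> \<rho>" if "X \<in> \<sigma>" for X
    using partition_on_disjoint_notin[OF prems(6,8) SV that] .
  \<comment> \<open>The last element of the union lies in \<open>V\<close>, so the recursion may
    remove any interval block of \<sigma>, including the last one.\<close>
  have MaxSV: "Max (S \<union> V) \<in> V"
  proof -
    have "Max V \<in> V" using prems by simp
    then have "Max (S \<union> V) = Max V"
      using prems(2) fin less_imp_le[OF prems(5)[OF _ \<open>Max V \<in> V\<close>]] by (intro Max_eqI) auto
    then show ?thesis using \<open>Max V \<in> V\<close> by simp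
  qed
  have inside: "convex_in (S \<union> V) W" if "convex_in S W" for W
    using that prems(5) unfolding convex_in_def by (meson UnE UnI1 less_asym subset_iff)
  have nx: "is_next (S \<union> V) W w" if "is_next S W w" for W w
    using that prems(5) unfolding is_next_def by (meson UnE UnI1 less_imp_le)
  have MaxS: "Max S \<in> S" using prems by simp
  let ?x = "Phi E V \<rho> a"
  show ?case
  proof (cases "\<sigma> = {S}")
    case True
    have cS: "convex_in (S \<union> V) S" using inside[of S] prems(3) unfolding convex_in_def by blast
    have "Max (S \<union> V) \<notin> S" using MaxSV SV by blast
    then have "rec_block (S \<union> V) (\<sigma> \<union> \<rho>) S"
      using True cS by (subst rec_block_iff[OF fin part]) auto
    then have "Phi E (S \<union> V) (\<sigma> \<union> \<rho>) a
        = Phi E (S \<union> V - S) ((\<sigma> \<union> \<rho>) - {S}) (absorb E (S \<union> V) S a)"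
      using Phi_remove fin part by blast
    moreover have "S \<union> V - S = V" "(\<sigma> \<union> \<rho>) - {S} = \<rho>" using SV disj True by blast+
    moreover have "absorb E (S \<union> V) S a = a(Min V := E (ordprod S a) * a (Min V))"
    proof -
      have "is_next (S \<union> V) S (Min V)" using prems unfolding is_next_def by auto
      then show ?thesis using next_after_eqI[OF fin cS] by (simp add: absorb_def)
    qed
    \<comment> \<open>The moment of \<open>S\<close> leaves \<rho> on the left through the first
      argument; below, the moment of \<rho> leaves \<open>E\<close> on the right through the last
      one. Both sides become the same product.\<close>
    moreover have "Phi E V \<rho> (a(Min V := E (ordprod S a) * a (Min V))) = E (ordprod S a) * ?x"
      unfolding Phi_def using prems by (intro phi_aux_mult_first) (auto simp: E_mem)
    moreover have "Phi E S \<sigma> (a(Max S := a (Max S) * ?x)) = E (ordprod S a) * ?x"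
      using prems(1) MaxS by (simp only: True Phi_singleton ordprod_upd_last Max_ge E_right Phi_mem)
    ultimately show ?thesis by simp
  next
    case False
    then obtain W where W: "rec_block S \<sigma> W"
      using noncrossing_rec_block_exists prems by blast
    note WS = W[unfolded rec_block_iff[OF prems(1,6)]]
    have sub: "W \<subseteq> S" "W \<noteq> {}" using WS unfolding convex_in_def by blast+
    obtain w where w: "is_next S W w" "next_after S W = w" "w \<notin> W" "w \<in> S"
      by (rule rec_block_next[OF prems(1,6) W])
    have nSV: "next_after (S \<union> V) W = w"
      using nx[OF w(1)] inside WS fin by (intro next_after_eqI) auto
    have "Max (S \<union> V) \<notin> W" using MaxSV sub SV by blast
    then have rSV: "rec_block (S \<union> V) (\<sigma> \<union> \<rho>) W"
      using inside WS by (subst rec_block_iff[OF fin part]) auto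
    let ?a = "absorb E S W a"
    have abs: "absorb E (S \<union> V) W a = ?a" by (simp add: absorb_def nSV w(2))
    have eqs: "S \<union> V - W = (S - W) \<union> V" "(\<sigma> \<union> \<rho>) - {W} = (\<sigma> - {W}) \<union> \<rho>"
      using SV sub disj WS by blast+
    have mx: "Max (S - W) = Max S" using WS prems(1,3) by (intro Max_diff) auto
    have "w \<notin> V" using w(4) SV by blast
    then have x: "Phi E V \<rho> ?a = ?x"
      using prems(2,8) w(2) by (intro Phi_cong) (auto simp: absorb_def)
    have MW: "Max S \<notin> W" using WS by blast
    have "Phi E (S \<union> V) (\<sigma> \<union> \<rho>) a = Phi E ((S - W) \<union> V) ((\<sigma> - {W}) \<union> \<rho>) ?a"
      using Phi_remove[OF fin part rSV] abs eqs by simp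
    also have "\<dots> = Phi E (S - W) (\<sigma> - {W}) (?a(Max (S - W) := ?a (Max (S - W)) * Phi E V \<rho> ?a))"
    proof (rule less.hyps)
      show "card (S - W) < card S" using sub prems(1) by (intro psubset_card_mono) auto
      show "S - W \<noteq> {}" using w by blast
      show "partition_on (S - W) (\<sigma> - {W})" using WS prems(6) partition_on_remove by blast
      show "noncrossing (\<sigma> - {W})" using prems(7) noncrossing_subset by blast
    qed (use prems in auto)
    \<comment> \<open>If \<open>w\<close> is \<open>Max S\<close>, both factors meet the same entry
      from opposite sides, and associativity makes their order irrelevant.\<close>
    also have "?a(Max (S - W) := ?a (Max (S - W)) * Phi E V \<rho> ?a)
        = absorb E S W (a(Max S := a (Max S) * ?x))"
    proof -
      have "ordprod W (a(Max S := a (Max S) * ?x)) = ordprod W a"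
        using MW by (intro ordprod_cong) auto
      then show ?thesis unfolding mx x using w(2) by (auto simp: absorb_def mult.assoc)
    qed
    also have "Phi E (S - W) (\<sigma> - {W}) \<dots> = Phi E S \<sigma> (a(Max S := a (Max S) * ?x))"
      by (rule Phi_remove[OF prems(1,6) W, symmetric])
    finally show ?thesis .
  qed
qed

lemma Phi_additive:
  assumes "finite S" "partition_on S \<sigma>" "i \<in> S"
  shows "Phi E S \<sigma> (a(i := x + y)) = Phi E S \<sigma> (a(i := x)) + Phi E S \<sigma> (a(i := y))"
  unfolding Phi_def using assms by (rule phi_aux_additive)

text \<open>Moebius values are integers, and an additive map commutes with integer
  multiples.\<close>

lemma Phi_sum_of_int:
  assumes "finite S" "partition_on S \<sigma>" "i \<in> S"
  shows "Phi E S \<sigma> (a(i := (\<Sum>t\<in>T. of_int (c t) * x t))) = (\<Sum>t\<in>T. of_int (c t) * Phi E S \<sigma> (a(i := x t)))"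
proof -
  define f where "f = (\<lambda>z. Phi E S \<sigma> (a(i := z)))"
  interpret additive f using Phi_additive[OF assms] by unfold_locales (simp add: f_def)
  have "f (of_int k * z) = of_int k * f z" for k z
    by (induction k rule: int_induct[of _ 0])
      (simp_all add: zero add diff distrib_right left_diff_distrib)
  then show ?thesis using sum[of "\<lambda>t. of_int (c t) * x t" T] by (simp add: f_def)
qed

end

section \<open>The interval below a partition with an interval block\<close>

lemma INC_partition: "\<sigma> \<in> INC \<chi> S \<Longrightarrow> partition_on S \<sigma>"
  by (simp add: INC_def)

lemma INC_noncrossing: "\<sigma> \<in> INC \<chi> S \<Longrightarrow> noncrossing \<sigma>"
  by (simp add: INC_def)

lemma INC_between:
  "\<lbrakk>\<sigma> \<in> INC \<chi> S; X \<in> \<sigma>; i \<in> X; k \<in> X; j \<in> S; i < j; j < k; \<chi> j = Bo\<rbrakk> \<Longrightarrow> j \<in> X"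
  unfolding INC_def mem_Collect_eq by meson

lemma INC_I:
  assumes "partition_on S \<sigma>" "noncrossing \<sigma>"
    and "\<And>X i j k. \<lbrakk>X \<in> \<sigma>; i \<in> X; k \<in> X; j \<in> S; i < j; j < k; \<chi> j = Bo\<rbrakk> \<Longrightarrow> j \<in> X"
  shows "\<sigma> \<in> INC \<chi> S"
  unfolding INC_def mem_Collect_eq using assms by meson

lemma partition_on_block: "\<lbrakk>partition_on S \<sigma>; X \<in> \<sigma>\<rbrakk> \<Longrightarrow> X \<subseteq> S \<and> X \<noteq> {}"
  by (auto simp: partition_on_def)

lemma partition_on_eq: "\<lbrakk>partition_on S \<sigma>; X \<in> \<sigma>; Y \<in> \<sigma>; X \<inter> Y \<noteq> {}\<rbrakk> \<Longrightarrow> X = Y"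
  unfolding partition_on_def by (meson disjointD)

text \<open>A block is enclosed by one of \<tau>, and that one by another block of \<sigma>; two
  blocks of \<sigma> that meet are equal, so all three are.\<close>

lemma refines_subset_of_antisym:
  assumes "partition_on S \<sigma>" "refines \<sigma> \<tau>" "refines \<tau> \<sigma>"
  shows "\<sigma> \<subseteq> \<tau>"
proof
  fix X assume X: "X \<in> \<sigma>"
  then obtain Y where Y: "Y \<in> \<tau>" "X \<subseteq> Y" using assms(2) unfolding refines_def by blast
  then obtain Z where Z: "Z \<in> \<sigma>" "Y \<subseteq> Z" using assms(3) unfolding refines_def by blast
  have "X = Z" using partition_on_eq[OF assms(1) X Z(1)] partition_on_block[OF assms(1) X] Y Z by blast
  then show "X \<in> \<tau>" using Y Z by simp
qed

lemma refines_trans: "\<lbrakk>refines \<sigma> \<tau>; refines \<tau> \<upsilon>\<rbrakk> \<Longrightarrow> refines \<sigma> \<upsilon>"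
  unfolding refines_def by (meson subset_trans)

lemma finite_poset_INC:
  assumes "finite S"
  shows "finite_poset refines (INC \<chi> S)"
proof
  have "INC \<chi> S \<subseteq> Pow (Pow S)" by (auto simp: INC_def partition_on_def)
  then show "finite (INC \<chi> S)" by (rule finite_subset) (simp add: assms)
  show "refines \<sigma> \<sigma>" for \<sigma> by (auto simp: refines_def)
  show "\<sigma> = \<tau>" if "\<sigma> \<in> INC \<chi> S" "\<tau> \<in> INC \<chi> S" "refines \<sigma> \<tau>" "refines \<tau> \<sigma>" for \<sigma> \<tau>
    using that refines_subset_of_antisym INC_partition by (metis subset_antisym)
qed (rule refines_trans)

lemma refines_Un_iff:
  assumes "partition_on S \<sigma>" "partition_on S \<tau>" "partition_on T \<sigma>'" "partition_on T \<tau>'" "S \<inter> T = {}"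
  shows "refines (\<sigma> \<union> \<sigma>') (\<tau> \<union> \<tau>') \<longleftrightarrow> refines \<sigma> \<tau> \<and> refines \<sigma>' \<tau>'"
proof
  assume r: "refines (\<sigma> \<union> \<sigma>') (\<tau> \<union> \<tau>')"
  have "\<exists>Y\<in>\<tau>. X \<subseteq> Y" if X: "X \<in> \<sigma>" for X
  proof -
    obtain Y where Y: "Y \<in> \<tau> \<union> \<tau>'" "X \<subseteq> Y" using r X unfolding refines_def by blast
    have "Y \<notin> \<tau>'"
      using partition_on_block[OF assms(1) X] partition_on_block[OF assms(4), of Y] Y(2) assms(5) by blast
    then show ?thesis using Y by blast
  qed
  moreover have "\<exists>Y\<in>\<tau>'. X \<subseteq> Y" if X: "X \<in> \<sigma>'" for X
  proof -
    obtain Y where Y: "Y \<in> \<tau> \<union> \<tau>'" "X \<subseteq> Y" using r X unfolding refines_def by blast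
    have "Y \<notin> \<tau>"
      using partition_on_block[OF assms(3) X] partition_on_block[OF assms(2), of Y] Y(2) assms(5) by blast
    then show ?thesis using Y by blast
  qed
  ultimately show "refines \<sigma> \<tau> \<and> refines \<sigma>' \<tau>'" by (simp add: refines_def)
next
  assume "refines \<sigma> \<tau> \<and> refines \<sigma>' \<tau>'"
  then show "refines (\<sigma> \<union> \<sigma>') (\<tau> \<union> \<tau>')" unfolding refines_def by blast
qed

text \<open>The two components can be read off from the union; this yields injectivity and lets
  functions of a pair be written as functions of the union.\<close>

lemma Un_blocks:
  assumes "partition_on S \<sigma>" "partition_on T \<tau>" "S \<inter> T = {}"
  shows "{X \<in> \<sigma> \<union> \<tau>. X \<subseteq> S} = \<sigma>" "{X \<in> \<sigma> \<union> \<tau>. X \<subseteq> T} = \<tau>"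
proof -
  have "X \<subseteq> S \<and> \<not> X \<subseteq> T" if "X \<in> \<sigma>" for X
    using partition_on_block[OF assms(1) that] assms(3) by blast
  moreover have "X \<subseteq> T \<and> \<not> X \<subseteq> S" if "X \<in> \<tau>" for X
    using partition_on_block[OF assms(2) that] assms(3) by blast
  ultimately show "{X \<in> \<sigma> \<union> \<tau>. X \<subseteq> S} = \<sigma>" "{X \<in> \<sigma> \<union> \<tau>. X \<subseteq> T} = \<tau>" by blast+
qed

lemma INC_blocks_subset:
  assumes "\<sigma> \<in> INC \<chi> S" "T \<subseteq> S" "\<And>X. X \<in> \<sigma> \<Longrightarrow> X \<subseteq> T \<or> X \<inter> T = {}"
  shows "{X \<in> \<sigma>. X \<subseteq> T} \<in> INC \<chi> T"
proof -
  note part = INC_partition[OF assms(1)]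
  have "T \<subseteq> \<Union>{X \<in> \<sigma>. X \<subseteq> T}"
  proof
    fix x assume x: "x \<in> T"
    then obtain X where "X \<in> \<sigma>" "x \<in> X" using part assms(2) unfolding partition_on_def by blast
    then show "x \<in> \<Union>{X \<in> \<sigma>. X \<subseteq> T}" using assms(3) x by blast
  qed
  then have "\<Union>{X \<in> \<sigma>. X \<subseteq> T} = T" by blast
  moreover have "disjoint {X \<in> \<sigma>. X \<subseteq> T}" "{} \<notin> {X \<in> \<sigma>. X \<subseteq> T}"
    using part unfolding partition_on_def disjoint_def by simp_all
  ultimately have "partition_on T {X \<in> \<sigma>. X \<subseteq> T}" by (simp add: partition_on_def)
  moreover have "noncrossing {X \<in> \<sigma>. X \<subseteq> T}"
    by (rule noncrossing_subset[OF INC_noncrossing[OF assms(1)]]) blast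
  moreover have "j \<in> X" if "X \<in> {X \<in> \<sigma>. X \<subseteq> T}" "i \<in> X" "k \<in> X" "j \<in> T" "i < j" "j < k" "\<chi> j = Bo"
    for X i j k
    using INC_between[OF assms(1) _ that(2,3) _ that(5-7)] that(1,4) assms(2) by blast
  ultimately show ?thesis by (rule INC_I)
qed

section \<open>The down-set of a partition with an interval block as a product\<close>

context
  fixes \<chi> :: "nat \<Rightarrow> fb" and S V :: "nat set" and \<pi> :: "nat set set"
  assumes fin: "finite S" and \<pi>: "\<pi> \<in> INC \<chi> S" and V: "V \<in> \<pi>" and conv: "convex_in S V"
begin

lemma V_sub: "V \<subseteq> S" "V \<noteq> {}" "finite V"
proof -
  show "V \<subseteq> S" "V \<noteq> {}" using conv unfolding convex_in_def by blast+
  then show "finite V" using fin finite_subset by blast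
qed

text \<open>A block of \<sigma> sits in a block of \<pi>, and \<open>V\<close> is one of these, so
  it lies either inside \<open>V\<close> or in the complement.\<close>

lemma INC_decompose:
  assumes "\<sigma> \<in> INC \<chi> S" "refines \<sigma> \<pi>"
  obtains \<tau> \<rho> where "\<tau> \<in> INC \<chi> (S - V)" "refines \<tau> (\<pi> - {V})" "\<rho> \<in> INC \<chi> V" "\<sigma> = \<tau> \<union> \<rho>"
proof -
  have split: "X \<subseteq> V \<or> X \<subseteq> S - V" if X: "X \<in> \<sigma>" for X
  proof -
    obtain Y where Y: "Y \<in> \<pi>" "X \<subseteq> Y" using assms(2) X unfolding refines_def by blast
    have "X \<subseteq> S" using partition_on_block[OF INC_partition[OF assms(1)] X] by blast
    moreover have "Y = V \<or> Y \<inter> V = {}" using partition_on_eq[OF INC_partition[OF \<pi>] Y(1) V] by blast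
    ultimately show ?thesis using Y by blast
  qed
  have "{X \<in> \<sigma>. X \<subseteq> V} \<in> INC \<chi> V"
    using split V_sub by (intro INC_blocks_subset[OF assms(1)]) blast+
  moreover have "{X \<in> \<sigma>. X \<subseteq> S - V} \<in> INC \<chi> (S - V)"
    using split by (intro INC_blocks_subset[OF assms(1)]) blast+
  moreover have "\<sigma> = {X \<in> \<sigma>. X \<subseteq> S - V} \<union> {X \<in> \<sigma>. X \<subseteq> V}" using split by blast
  moreover have "refines {X \<in> \<sigma>. X \<subseteq> S - V} (\<pi> - {V})"
    unfolding refines_def
  proof
    fix X assume X: "X \<in> {X \<in> \<sigma>. X \<subseteq> S - V}"
    then obtain Y where Y: "Y \<in> \<pi>" "X \<subseteq> Y" using assms(2) unfolding refines_def by blast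
    have "X \<noteq> {}" using partition_on_block[OF INC_partition[OF assms(1)]] X by blast
    then have "Y \<noteq> V" using X Y by blast
    then show "\<exists>Y\<in>\<pi> - {V}. X \<subseteq> Y" using Y by blast
  qed
  ultimately show ?thesis using that by blast
qed

lemma remove_INC: "\<pi> - {V} \<in> INC \<chi> (S - V)"
proof -
  have "partition_on (S - V) (\<pi> - {V})" using partition_on_remove[OF INC_partition[OF \<pi>] V] .
  moreover have "noncrossing (\<pi> - {V})" using noncrossing_subset[OF INC_noncrossing[OF \<pi>]] by blast
  ultimately show ?thesis by (rule INC_I) (use INC_between[OF \<pi>] in blast)
qed

lemma singleton_INC: "{V} \<in> INC \<chi> V"
  using V_sub by (simp add: INC_def noncrossing_def partition_on_def)

lemma refines_singleton: "\<rho> \<in> INC \<chi> V \<Longrightarrow> refines \<rho> {V}"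
  using partition_on_block[OF INC_partition, of \<rho> \<chi> V] by (simp add: refines_def)

text \<open>A crossing of a block of \<tau> with a block of \<rho> would place a point outside
  \<open>V\<close> between two points of \<open>V\<close>, contrary to convexity.\<close>

lemma Un_INC:
  assumes "\<tau> \<in> INC \<chi> (S - V)" "refines \<tau> (\<pi> - {V})" "\<rho> \<in> INC \<chi> V"
  shows "\<tau> \<union> \<rho> \<in> INC \<chi> S" "refines (\<tau> \<union> \<rho>) \<pi>"
proof -
  note part = INC_partition[OF assms(1)] INC_partition[OF assms(3)]
  have p: "partition_on S (\<tau> \<union> \<rho>)"
    using partition_on_Un[OF part] V_sub by (simp add: Un_absorb2 Int_commute)
  have sub: "X \<subseteq> S - V" if "X \<in> \<tau>" for X using partition_on_block[OF part(1) that] by blast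
  have sub': "X \<subseteq> V" if "X \<in> \<rho>" for X using partition_on_block[OF part(2) that] by blast
  have conv': "j \<in> V" if "i \<in> V" "k \<in> V" "j \<in> S" "i < j" "j < k" for i j k
    using conv that unfolding convex_in_def by blast
  have nc: "noncrossing (\<tau> \<union> \<rho>)"
    unfolding noncrossing_def
  proof (intro ballI impI notI)
    fix X Y assume X: "X \<in> \<tau> \<union> \<rho>" and Y: "Y \<in> \<tau> \<union> \<rho>" and ne: "X \<noteq> Y"
      and "\<exists>a\<in>X. \<exists>b\<in>Y. \<exists>c\<in>X. \<exists>d\<in>Y. a < b \<and> b < c \<and> c < d"
    then obtain a b c d where *: "a \<in> X" "b \<in> Y" "c \<in> X" "d \<in> Y" "a < b" "b < c" "c < d" by blast
    consider "X \<in> \<tau>" "Y \<in> \<tau>" | "X \<in> \<rho>" "Y \<in> \<rho>" | "X \<in> \<tau>" "Y \<in> \<rho>" | "X \<in> \<rho>" "Y \<in> \<tau>"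
      using X Y by blast
    then show False
    proof cases
      case 1
      then show ?thesis using noncrossingD[OF INC_noncrossing[OF assms(1)] _ _ ne] * by blast
    next
      case 2
      then show ?thesis using noncrossingD[OF INC_noncrossing[OF assms(3)] _ _ ne] * by blast
    next
      case 3
      then show ?thesis using conv'[of b d c] sub[of X] sub'[of Y] * by blast
    next
      case 4
      then show ?thesis using conv'[of a c b] sub[of Y] sub'[of X] * by blast
    qed
  qed
  have bo: "w \<in> X" if X: "X \<in> \<tau> \<union> \<rho>" and *: "v1 \<in> X" "v2 \<in> X" "w \<in> S" "v1 < w" "w < v2" "\<chi> w = Bo"
    for X v1 v2 w
  proof (cases "X \<in> \<rho>")
    case True
    then have "w \<in> V" using conv' sub' * by blast
    then show ?thesis using INC_between[OF assms(3) True] * by blast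
  next
    case False
    then have X': "X \<in> \<tau>" using X by blast
    \<comment> \<open>A block of \<tau> may surround \<open>V\<close>. A Boolean point of
      \<open>V\<close> below such an arch would, by the condition on \<pi>, belong to the enclosing
      block of \<pi>, which is disjoint from \<open>V\<close>.\<close>
    have "w \<notin> V"
    proof
      assume w: "w \<in> V"
      obtain U where U: "U \<in> \<pi>" "U \<noteq> V" "X \<subseteq> U" using assms(2) X' unfolding refines_def by blast
      then have "w \<in> U" using INC_between[OF \<pi> U(1)] * by blast
      then show False using partition_on_eq[OF INC_partition[OF \<pi>] U(1) V] U w by blast
    qed
    then show ?thesis using INC_between[OF assms(1) X'] * by blast
  qed
  show "\<tau> \<union> \<rho> \<in> INC \<chi> S" by (rule INC_I[OF p nc bo])
  show "refines (\<tau> \<union> \<rho>) \<pi>"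
    using assms(2) sub' V unfolding refines_def by blast
qed

lemma refines_Un_INC:
  assumes "\<tau> \<in> INC \<chi> (S - V)" "\<tau>' \<in> INC \<chi> (S - V)" "\<rho> \<in> INC \<chi> V" "\<rho>' \<in> INC \<chi> V"
  shows "refines (\<tau> \<union> \<rho>) (\<tau>' \<union> \<rho>') \<longleftrightarrow> refines \<tau> \<tau>' \<and> refines \<rho> \<rho>'"
  by (rule refines_Un_iff[OF assms[THEN INC_partition]]) blast

lemma Un_blocks_INC:
  assumes "\<tau> \<in> INC \<chi> (S - V)" "\<rho> \<in> INC \<chi> V"
  shows "{X \<in> \<tau> \<union> \<rho>. X \<subseteq> S - V} = \<tau>" "{X \<in> \<tau> \<union> \<rho>. X \<subseteq> V} = \<rho>"
  using Un_blocks[OF INC_partition[OF assms(1)] INC_partition[OF assms(2)]]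
  by (simp_all add: Int_commute)

lemma inj_on_Un_INC: "inj_on (\<lambda>(\<tau>, \<rho>). \<tau> \<union> \<rho>) (INC \<chi> (S - V) \<times> INC \<chi> V)"
proof (rule inj_onI, clarify)
  fix \<tau> \<rho> \<tau>' \<rho>'
  assume *: "\<tau> \<in> INC \<chi> (S - V)" "\<rho> \<in> INC \<chi> V" "\<tau>' \<in> INC \<chi> (S - V)" "\<rho>' \<in> INC \<chi> V" "\<tau> \<union> \<rho> = \<tau>' \<union> \<rho>'"
  then show "\<tau> = \<tau>' \<and> \<rho> = \<rho>'" using Un_blocks_INC[of \<tau> \<rho>] Un_blocks_INC[of \<tau>' \<rho>'] by simp
qed

text \<open>Intervals below \<pi> are products of intervals, so the product of the two Moebius
  functions satisfies the sums that determine the Moebius function of the union.\<close>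

lemma mobius_Un:
  assumes "\<tau> \<in> INC \<chi> (S - V)" "refines \<tau> (\<pi> - {V})" "\<rho> \<in> INC \<chi> V"
  shows "mobius refines (INC \<chi> S) (\<tau> \<union> \<rho>) \<pi>
      = mobius refines (INC \<chi> (S - V)) \<tau> (\<pi> - {V}) * mobius refines (INC \<chi> V) \<rho> {V}"
proof -
  interpret S: finite_poset refines "INC \<chi> S" by (rule finite_poset_INC[OF fin])
  interpret S': finite_poset refines "INC \<chi> (S - V)" by (rule finite_poset_INC) (simp add: fin)
  interpret V: finite_poset refines "INC \<chi> V" by (rule finite_poset_INC[OF V_sub(3)])
  let ?\<mu>1 = "mobius refines (INC \<chi> (S - V)) \<tau>" and ?\<mu>2 = "mobius refines (INC \<chi> V) \<rho>"
  \<comment> \<open>The candidate must be a function of one partition, so its two arguments are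
    recovered from the blocks on either side.\<close>
  let ?g = "\<lambda>r. ?\<mu>1 {X \<in> r. X \<subseteq> S - V} * ?\<mu>2 {X \<in> r. X \<subseteq> V}"
  have "mobius refines (INC \<chi> S) (\<tau> \<union> \<rho>) \<pi> = ?g \<pi>"
  proof (rule S.mobius_unique)
    show "\<tau> \<union> \<rho> \<in> INC \<chi> S" "refines (\<tau> \<union> \<rho>) \<pi>" using Un_INC[OF assms] by blast+
    show "\<pi> \<in> INC \<chi> S" by (rule \<pi>)
    fix q assume q: "q \<in> INC \<chi> S" "refines (\<tau> \<union> \<rho>) q" "refines q \<pi>"
    obtain \<tau>' \<rho>' where q': "\<tau>' \<in> INC \<chi> (S - V)" "refines \<tau>' (\<pi> - {V})" "\<rho>' \<in> INC \<chi> V" "q = \<tau>' \<union> \<rho>'"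
      by (rule INC_decompose[OF q(1,3)])
    have le: "refines \<tau> \<tau>'" "refines \<rho> \<rho>'" using q(2) q' assms refines_Un_INC by blast+
    let ?I1 = "{r \<in> INC \<chi> (S - V). refines \<tau> r \<and> refines r \<tau>'}"
    let ?I2 = "{r \<in> INC \<chi> V. refines \<rho> r \<and> refines r \<rho>'}"
    \<comment> \<open>Since \<open>q\<close> is below \<pi>, so is every \<open>r\<close> in the
      interval, and each \<open>r\<close> decomposes.\<close>
    have "{r \<in> INC \<chi> S. refines (\<tau> \<union> \<rho>) r \<and> refines r q} = (\<lambda>(x, y). x \<union> y) ` (?I1 \<times> ?I2)"
    proof (intro equalityI subsetI)
      fix r assume r: "r \<in> {r \<in> INC \<chi> S. refines (\<tau> \<union> \<rho>) r \<and> refines r q}"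
      then have "r \<in> INC \<chi> S" "refines r \<pi>" using refines_trans q(3) by blast+
      then obtain x y where xy: "x \<in> INC \<chi> (S - V)" "y \<in> INC \<chi> V" "r = x \<union> y"
        by (rule INC_decompose)
      then have "(x, y) \<in> ?I1 \<times> ?I2" using r q' assms by (simp add: refines_Un_INC)
      then show "r \<in> (\<lambda>(x, y). x \<union> y) ` (?I1 \<times> ?I2)" using xy(3) by force
    next
      fix r assume "r \<in> (\<lambda>(x, y). x \<union> y) ` (?I1 \<times> ?I2)"
      then obtain x y where xy: "x \<in> ?I1" "y \<in> ?I2" "r = x \<union> y" by auto
      then have "refines x (\<pi> - {V})" using refines_trans q'(2) by blast
      then have "r \<in> INC \<chi> S" using xy Un_INC by blast
      then show "r \<in> {r \<in> INC \<chi> S. refines (\<tau> \<union> \<rho>) r \<and> refines r q}"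
        using xy q' assms by (simp add: refines_Un_INC)
    qed
    moreover have "inj_on (\<lambda>(x, y). x \<union> y) (?I1 \<times> ?I2)"
      by (rule inj_on_subset[OF inj_on_Un_INC]) blast
    ultimately have "sum ?g {r \<in> INC \<chi> S. refines (\<tau> \<union> \<rho>) r \<and> refines r q}
        = (\<Sum>(x, y)\<in>?I1 \<times> ?I2. ?g (x \<union> y))"
      by (simp add: sum.reindex case_prod_unfold)
    also have "\<dots> = (\<Sum>(x, y)\<in>?I1 \<times> ?I2. ?\<mu>1 x * ?\<mu>2 y)"
    proof (rule sum.cong[OF refl], clarify)
      fix x y assume "x \<in> INC \<chi> (S - V)" "y \<in> INC \<chi> V"
      then show "?g (x \<union> y) = ?\<mu>1 x * ?\<mu>2 y" by (simp only: Un_blocks_INC)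
    qed
    \<comment> \<open>A sum over a product of intervals splits into two factors, each of which is a
      Kronecker delta.\<close>
    also have "\<dots> = (\<Sum>x\<in>?I1. ?\<mu>1 x) * (\<Sum>y\<in>?I2. ?\<mu>2 y)"
      by (simp add: sum_product sum.cartesian_product)
    also have "\<dots> = (if \<tau> = \<tau>' then 1 else 0) * (if \<rho> = \<rho>' then 1 else 0)"
      using S'.sum_mobius[OF assms(1) q'(1) le(1)] V.sum_mobius[OF assms(3) q'(3) le(2)] by simp
    also have "\<dots> = (if \<tau> \<union> \<rho> = q then 1 else 0)"
    proof -
      have "\<tau> \<union> \<rho> = q \<longleftrightarrow> \<tau> = \<tau>' \<and> \<rho> = \<rho>'"
        using Un_blocks_INC[OF assms(1,3)] Un_blocks_INC[OF q'(1,3)] q'(4) by metis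
      then show ?thesis by simp
    qed
    finally show "sum ?g {r \<in> INC \<chi> S. refines (\<tau> \<union> \<rho>) r \<and> refines r q}
        = (if \<tau> \<union> \<rho> = q then 1 else 0)" .
  qed
  also have "\<dots> = ?\<mu>1 (\<pi> - {V}) * ?\<mu>2 {V}"
  proof -
    have "(\<pi> - {V}) \<union> {V} = \<pi>" using V by blast
    then show ?thesis using Un_blocks_INC[OF remove_INC singleton_INC] by (simp only:)
  qed
  finally show ?thesis .
qed

text \<open>In the theorem, \<open>G\<close> is \<open>\<lambda>x. x * a (l + s + 1)\<close> or \<open>\<lambda>x. a l * x\<close>.\<close>

lemma kappa_interval:
  assumes "bimodule_expectation E B" and "i \<in> S - V" and "additive G"
    and "\<And>k x. G (of_int k * x) = of_int k * G x"
    and "\<And>\<tau> \<rho>. \<lbrakk>\<tau> \<in> INC \<chi> (S - V); \<rho> \<in> INC \<chi> V\<rbrakk> \<Longrightarrow>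
      Phi E S (\<tau> \<union> \<rho>) a = Phi E (S - V) \<tau> (a(i := G (Phi E V \<rho> a)))"
  shows "kappa E \<chi> S \<pi> a = kappa E \<chi> (S - V) (\<pi> - {V}) (a(i := G (kappa E \<chi> V {V} a)))"
proof -
  interpret bimodule_expectation E B by fact
  interpret G: additive G by fact
  let ?D = "{\<tau> \<in> INC \<chi> (S - V). refines \<tau> (\<pi> - {V})}" and ?R = "INC \<chi> V"
  let ?\<mu>1 = "\<lambda>\<tau>. mobius refines (INC \<chi> (S - V)) \<tau> (\<pi> - {V})" and ?\<mu>2 = "\<lambda>\<rho>. mobius refines ?R \<rho> {V}"
  let ?F = "\<lambda>\<sigma>. of_int (mobius refines (INC \<chi> S) \<sigma> \<pi>) * Phi E S \<sigma> a"
  have "{\<sigma> \<in> INC \<chi> S. refines \<sigma> \<pi>} = (\<lambda>(\<tau>, \<rho>). \<tau> \<union> \<rho>) ` (?D \<times> ?R)"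
  proof (intro equalityI subsetI)
    fix \<sigma> assume "\<sigma> \<in> {\<sigma> \<in> INC \<chi> S. refines \<sigma> \<pi>}"
    then have "\<sigma> \<in> INC \<chi> S" "refines \<sigma> \<pi>" by blast+
    then obtain \<tau> \<rho> where "\<tau> \<in> INC \<chi> (S - V)" "refines \<tau> (\<pi> - {V})" "\<rho> \<in> ?R" "\<sigma> = \<tau> \<union> \<rho>"
      by (rule INC_decompose)
    then show "\<sigma> \<in> (\<lambda>(\<tau>, \<rho>). \<tau> \<union> \<rho>) ` (?D \<times> ?R)" by force
  next
    fix \<sigma> assume "\<sigma> \<in> (\<lambda>(\<tau>, \<rho>). \<tau> \<union> \<rho>) ` (?D \<times> ?R)"
    then show "\<sigma> \<in> {\<sigma> \<in> INC \<chi> S. refines \<sigma> \<pi>}" using Un_INC by auto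
  qed
  moreover have "inj_on (\<lambda>(\<tau>, \<rho>). \<tau> \<union> \<rho>) (?D \<times> ?R)"
    by (rule inj_on_subset[OF inj_on_Un_INC]) blast
  ultimately have "kappa E \<chi> S \<pi> a = (\<Sum>(\<tau>, \<rho>)\<in>?D \<times> ?R. ?F (\<tau> \<union> \<rho>))"
    unfolding kappa_def by (simp add: sum.reindex case_prod_unfold)
  also have "\<dots> = (\<Sum>(\<tau>, \<rho>)\<in>?D \<times> ?R. of_int (?\<mu>1 \<tau>) *
      (of_int (?\<mu>2 \<rho>) * Phi E (S - V) \<tau> (a(i := G (Phi E V \<rho> a)))))"
  proof (rule sum.cong[OF refl], clarify)
    fix \<tau> \<rho> assume "\<tau> \<in> INC \<chi> (S - V)" "refines \<tau> (\<pi> - {V})" "\<rho> \<in> ?R"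
    then show "?F (\<tau> \<union> \<rho>) = of_int (?\<mu>1 \<tau>) * (of_int (?\<mu>2 \<rho>) * Phi E (S - V) \<tau> (a(i := G (Phi E V \<rho> a))))"
      by (simp only: mobius_Un assms(5) of_int_mult mult.assoc)
  qed
  also have "\<dots> = (\<Sum>\<tau>\<in>?D. of_int (?\<mu>1 \<tau>) *
      (\<Sum>\<rho>\<in>?R. of_int (?\<mu>2 \<rho>) * Phi E (S - V) \<tau> (a(i := G (Phi E V \<rho> a)))))"
    by (simp only: sum_distrib_left sum.cartesian_product)
  \<comment> \<open>For fixed \<tau> the sum over \<rho> moves into the argument at \<open>i\<close>
    and, through \<open>G\<close>, becomes the cumulant of \<open>V\<close>.\<close>
  also have "\<dots> = (\<Sum>\<tau>\<in>?D. of_int (?\<mu>1 \<tau>) * Phi E (S - V) \<tau> (a(i := G (kappa E \<chi> V {V} a))))"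
  proof (rule sum.cong[OF refl])
    fix \<tau> assume "\<tau> \<in> ?D"
    then have "partition_on (S - V) \<tau>" using INC_partition by blast
    then have "(\<Sum>\<rho>\<in>?R. of_int (?\<mu>2 \<rho>) * Phi E (S - V) \<tau> (a(i := G (Phi E V \<rho> a))))
        = Phi E (S - V) \<tau> (a(i := (\<Sum>\<rho>\<in>?R. of_int (?\<mu>2 \<rho>) * G (Phi E V \<rho> a))))"
      using fin assms(2) by (intro Phi_sum_of_int[symmetric]) auto
    also have "(\<Sum>\<rho>\<in>?R. of_int (?\<mu>2 \<rho>) * G (Phi E V \<rho> a)) = G (kappa E \<chi> V {V} a)"
    proof -
      \<comment> \<open>\<open>{V}\<close> is the greatest element of \<open>INC \<chi> V\<close>,
        so the cumulant sums over all of it.\<close>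
      have "{\<rho> \<in> ?R. refines \<rho> {V}} = ?R" using refines_singleton by blast
      then show ?thesis by (simp add: kappa_def G.sum assms(4))
    qed
    finally show "of_int (?\<mu>1 \<tau>) * (\<Sum>\<rho>\<in>?R. of_int (?\<mu>2 \<rho>) * Phi E (S - V) \<tau> (a(i := G (Phi E V \<rho> a))))
        = of_int (?\<mu>1 \<tau>) * Phi E (S - V) \<tau> (a(i := G (kappa E \<chi> V {V} a)))"
      by (rule arg_cong)
  qed
  finally show ?thesis unfolding kappa_def[of E \<chi> "S - V"] .
qed

end

section \<open>Restriction of the partition and the factorisation of cumulants\<close>

lemma restrict_part_remove:
  assumes "partition_on S \<pi>" "V \<in> \<pi>"
  shows "restrict_part \<pi> (S - V) = \<pi> - {V}"
proof -
  have *: "X \<inter> (S - V) = X \<and> X \<noteq> {}" if "X \<in> \<pi>" "X \<noteq> V" for X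
    using partition_on_block[OF assms(1) that(1)] partition_on_eq[OF assms(1) that(1) assms(2)] that(2) by blast
  \<comment> \<open>\<open>V\<close> restricts to the empty set, which \<open>restrict_part\<close>
    discards; every other block is disjoint from \<open>V\<close> and unchanged.\<close>
  have "\<pi> = insert V (\<pi> - {V})" using assms(2) by blast
  then have "(\<lambda>X. X \<inter> (S - V)) ` \<pi> = insert (V \<inter> (S - V)) ((\<lambda>X. X \<inter> (S - V)) ` (\<pi> - {V}))"
    by (metis image_insert)
  also have "(\<lambda>X. X \<inter> (S - V)) ` (\<pi> - {V}) = \<pi> - {V}"
    using * by (simp add: image_cong[of _ _ _ "\<lambda>X. X"])
  finally have "(\<lambda>X. X \<inter> (S - V)) ` \<pi> = insert {} (\<pi> - {V})" by simp
  moreover have "{} \<notin> \<pi> - {V}" using * by blast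
  ultimately show ?thesis by (simp add: restrict_part_def)
qed

text \<open>The one-sided module properties come from the two-sided one by taking 1 as the other
  factor.\<close>

lemma bimodule_expectation_of_B_prob_space:
  assumes "B_prob_space \<iota> B E"
  shows "bimodule_expectation E B"
proof
  have one: "1 \<in> B" and mod: "\<And>b1 b2 x. \<lbrakk>b1 \<in> B; b2 \<in> B\<rbrakk> \<Longrightarrow> E (b1 * x * b2) = b1 * E x * b2"
    using assms by (simp_all add: B_prob_space_def unital_subalg_def)
  show "E (x + y) = E x + E y" for x y using assms by (simp add: B_prob_space_def)
  show "E x \<in> B" for x using assms by (auto simp: B_prob_space_def)
  show "E (b * x) = b * E x" if "b \<in> B" for b x using mod[OF that one, of x] by simp
  show "E (x * b) = E x * b" if "b \<in> B" for b x using mod[OF one that, of x] by simp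
qed

text \<open>Each equation is stated where its target exists: \<open>l + s + 1\<close> is a position
  only if \<open>l + s < n\<close>, and \<open>l\<close> only if \<open>0 < l\<close>.\<close>

theorem theorem4p2:
  fixes \<iota> :: "complex \<Rightarrow> 'a::ring_1" and B :: "'a set" and E :: "'a \<Rightarrow> 'a"
    and \<chi> :: "nat \<Rightarrow> fb" and \<pi> :: "nat set set" and a :: "nat \<Rightarrow> 'a"
    and n l s :: nat and V :: "nat set"
  assumes "B_prob_space \<iota> B E"
    and "\<pi> \<in> INC \<chi> {1..n}"
    and "V \<in> \<pi>" and "V = {l+1..l+s}"
  shows "(l + s < n \<longrightarrow>
           kappa E \<chi> {1..n} \<pi> a =
           kappa E \<chi> ({1..n} - V) (restrict_part \<pi> ({1..n} - V))
             (a(l+s+1 := kappa E \<chi> V {V} a * a (l+s+1))))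
       \<and> (0 < l \<longrightarrow>
           kappa E \<chi> {1..n} \<pi> a =
           kappa E \<chi> ({1..n} - V) (restrict_part \<pi> ({1..n} - V))
             (a(l := a l * kappa E \<chi> V {V} a)))"
proof -
  let ?S = "{1..n}"
  have be: "bimodule_expectation E B" using bimodule_expectation_of_B_prob_space[OF assms(1)] .
  then interpret bimodule_expectation E B .
  note part = INC_partition[OF assms(2)]
  have V: "V \<subseteq> ?S" "V \<noteq> {}" using partition_on_block[OF part assms(3)] by blast+
  then have s: "s > 0" "l + s \<le> n" using assms(4) by auto
  have conv: "convex_in ?S V" using V assms(4) by (auto simp: convex_in_def)
  have restr: "restrict_part \<pi> (?S - V) = \<pi> - {V}" using restrict_part_remove[OF part assms(3)] .
  have right: "Phi E ?S (\<tau> \<union> \<rho>) a = Phi E (?S - V) \<tau> (a(l+s+1 := Phi E V \<rho> a * a (l+s+1)))"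
    if "l + s < n" "\<tau> \<in> INC \<chi> (?S - V)" "\<rho> \<in> INC \<chi> V" for \<tau> \<rho>
  proof (rule Phi_interval_right)
    have "Max ?S = n" using that(1) by (intro Max_eqI) auto
    then show "Max ?S \<notin> V" using that(1) assms(4) by simp
    show "is_next ?S V (l + s + 1)" using that(1) assms(4) by (auto simp: is_next_def)
  qed (use conv that INC_partition INC_noncrossing in auto)
  have left: "Phi E ?S (\<tau> \<union> \<rho>) a = Phi E (?S - V) \<tau> (a(l := a l * Phi E V \<rho> a))"
    if "0 < l" "\<tau> \<in> INC \<chi> (?S - V)" "\<rho> \<in> INC \<chi> V" for \<tau> \<rho>
  proof (cases "l + s < n")
    \<comment> \<open>Without \<open>V\<close> the positions \<open>l\<close> and
      \<open>l + s + 1\<close> are adjacent, so the moment of \<open>V\<close>, an element of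
      \<open>B\<close>, moves from the right one to the left one.\<close>
    case True
    show ?thesis
      unfolding right[OF True that(2,3)]
      using that True assms(4) INC_partition
      by (intro Phi_shift) (auto simp: Phi_mem)
  next
    \<comment> \<open>\<open>V\<close> reaches up to \<open>n\<close>, so nothing lies to its right
      and the version for a final interval applies.\<close>
    case False
    then have n: "n = l + s" using s by simp
    have SV: "?S - V = {1..l}" "{1..l} \<union> V = ?S" using n assms(4) by auto
    have "Max {1..l} = l" using that(1) by (intro Max_eqI) auto
    moreover have "Phi E ({1..l} \<union> V) (\<tau> \<union> \<rho>) a
        = Phi E {1..l} \<tau> (a(Max {1..l} := a (Max {1..l}) * Phi E V \<rho> a))"
      using that(1) V(2) assms(4) INC_partition[OF that(2)[unfolded SV(1)]]
        INC_noncrossing[OF that(2)] INC_partition[OF that(3)]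
      by (intro Phi_interval_last) auto
    ultimately show ?thesis unfolding SV by simp
  qed
  have "kappa E \<chi> ?S \<pi> a = kappa E \<chi> (?S - V) (\<pi> - {V}) (a(l+s+1 := kappa E \<chi> V {V} a * a (l+s+1)))"
    if "l + s < n"
  proof (rule kappa_interval[OF _ assms(2,3) conv be, where G = "\<lambda>x. x * a (l+s+1)"])
    show "additive (\<lambda>x. x * a (l+s+1))" by unfold_locales (rule distrib_right)
    show "l + s + 1 \<in> ?S - V" using that assms(4) by auto
  qed (use right[OF that] in \<open>auto simp: mult.assoc\<close>)
  moreover have "kappa E \<chi> ?S \<pi> a = kappa E \<chi> (?S - V) (\<pi> - {V}) (a(l := a l * kappa E \<chi> V {V} a))"
    if "0 < l"
  proof (rule kappa_interval[OF _ assms(2,3) conv be, where G = "\<lambda>x. a l * x"])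
    show "additive (\<lambda>x. a l * x)" by unfold_locales (rule distrib_left)
    show "l \<in> ?S - V" using that s assms(4) by auto
    \<comment> \<open>Integer multiples of 1 are central, so left multiplication by
      \<open>a l\<close> respects them.\<close>
    show "a l * (of_int k * x) = of_int k * (a l * x)" for k x
      by (metis mult.assoc mult_of_int_commute)
  qed (use left[OF that] in auto)
  ultimately show ?thesis unfolding restr by blast
qed

end
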